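(* Suppose $M$ is an irreducible finite projection monoid on $\mathbb{C}^2$. Then $M$ or its dual $M^*$ is equivalent to one of the following projection monoids: $X_S^{(i)}$ (for some $i\in\{0,1,2\}$ and some finite set $S$ of roots of unity in $\mathbb C$ with $1\in S$ and $i+|S|\geq 2$), $Y_w$ (for some root of unity $w\neq\pm1$ in $\mathbb C$), or $Z^{(i)}$ (for some $i\in\{0,1,2,3,4,5\}$).
   Context: A projection on a finite-dimensional vector space $V$ over a field is an idempotent linear map $V\to V$ whose kernel has dimension $1$ (so its image has codimension $1$). A projection monoid on $V$ is a submonoid of $\operatorname{End}(V)$ generated by projections. It is irreducible if there is no subspace $0<W<V$ mapped into itself by all elements of $M$. Projection monoids $M$ on $V$ and $N$ on $W$ are equivalent if there is a bijective linear map $f:V\to W$ with $N=\{fmf^{-1}: m\in M\}$. The dual of $M$ is the projection monoid $M^*=\{m^*:m\in M\}$ on the dual space $V^*$, where $m^*$ is the dual map of $m$. For a line $K$ and a hyperplane $L$ with $K\not\leq L$, $\mathrm{prj}(K,L)$ denotes the projection with kernel $K$ and image $L$. The kernels of $M$ are the kernels of the projections in $M$, and the images of $M$ are the images of the projections in $M$. $M$ is complete if $\mathrm{prj}(K,L)\in M$ whenever $K$ is a kernel of $M$, $L$ is an image of $M$ and $K\not\leq L$. Each monoid below is the complete projection monoid on $\mathbb C^2$ with the listed kernels and images, i.e. the monoid generated by all $\mathrm{prj}(K,L)$ with $K$ a listed kernel, $L$ a listed image, $K\ne L$. Write $\langle x,y\rangle$ for the line in $\mathbb C^2$ spanned by the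 column vector with entries $x,y$. (1) For $S$ a finite set of roots of unity in $\mathbb C$ with $1\in S$, and $i\in\{0,1,2\}$ with $i+|S|\ge2$: $X_S^{(i)}$ has images $\langle1,0\rangle,\langle0,1\rangle$; its kernels are the lines $\langle1,s\rangle$ for $s\in S$, together with nothing else if $i=0$, with $\langle1,0\rangle$ if $i=1$, and with $\langle1,0\rangle$ and $\langle0,1\rangle$ if $i=2$. (2) For a root of unity $w\ne\pm1$ in $\mathbb{C}$: $Y_w$ has images $\langle1,1\rangle,\langle1,0\rangle,\langle1,1+w\rangle$ and kernels $\langle1,1\rangle,\langle0,1\rangle,\langle1-w,1\rangle$. (3) Let $\omega\in\mathbb C$ be a fixed primitive cube root of unity. For $i=0,1,2,3,4$ the images of $Z^{(i)}$ are $\langle1,0\rangle,\langle0,1\rangle,\langle-1,1\rangle$. The kernels of $Z^{(i)}$ are $\langle1,0\rangle$, $\langle0,1\rangle$ together with: $\langle-1,1\rangle$ for $i=0$; $\langle\omega,1\rangle$ for $i=1$; $\langle\omega,1\rangle,\langle\omega^2,1\rangle$ for $i=2$; $\langle-1,1\rangle,\langle\omega,1\rangle$ for $i=3$; $\langle-1,1\rangle,\langle\omega,1\rangle,\langle\omega^2,1\rangle$ for $i=4$. $Z^{(5)}$ has both its images and its kernels equal to $\langle1,0\rangle,\langle0,1\rangle,\langle-1,1\rangle,\langle\omega,1\rangle$. *)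

theory Defs
  imports "HOL-Analysis.Analysis"
begin

section \<open>Projection monoids\<close>

text \<open>
  A vector space is given, as in \<^theory>\<open>HOL.Vector_Spaces\<close>, by its scalar multiplication on a
  whole type; the elements of \<open>End(V)\<close> are the linear functions on that type.
\<close>

definition is_projection :: "('k::field \<Rightarrow> 'v::ab_group_add \<Rightarrow> 'v) \<Rightarrow> ('v \<Rightarrow> 'v) \<Rightarrow> bool" where
  "is_projection smul p \<longleftrightarrow>
     Vector_Spaces.linear smul smul p \<and> p \<circ> p = p \<and> vector_space.dim smul {v. p v = 0} = 1"

inductive_set generated_monoid :: "('v \<Rightarrow> 'v) set \<Rightarrow> ('v \<Rightarrow> 'v) set" for G where
  one: "id \<in> generated_monoid G"
| gen: "g \<in> G \<Longrightarrow> g \<in> generated_monoid G"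
| mult: "a \<in> generated_monoid G \<Longrightarrow> b \<in> generated_monoid G \<Longrightarrow> a \<circ> b \<in> generated_monoid G"

definition projection_monoid ::
  "('k::field \<Rightarrow> 'v::ab_group_add \<Rightarrow> 'v) \<Rightarrow> ('v \<Rightarrow> 'v) set \<Rightarrow> bool" where
  "projection_monoid smul M \<longleftrightarrow>
     (\<exists>G. (\<forall>g\<in>G. is_projection smul g) \<and> M = generated_monoid G)"

definition irreducible_monoid ::
  "('k::field \<Rightarrow> 'v::ab_group_add \<Rightarrow> 'v) \<Rightarrow> ('v \<Rightarrow> 'v) set \<Rightarrow> bool" where
  "irreducible_monoid smul M \<longleftrightarrow>
     \<not> (\<exists>W. module.subspace smul W \<and> {0} \<subset> W \<and> W \<subset> UNIV \<and> (\<forall>m\<in>M. m ` W \<subseteq> W))"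

definition equivalent_monoids ::
  "('k::field \<Rightarrow> 'v::ab_group_add \<Rightarrow> 'v) \<Rightarrow> ('k \<Rightarrow> 'w::ab_group_add \<Rightarrow> 'w) \<Rightarrow>
   ('v \<Rightarrow> 'v) set \<Rightarrow> ('w \<Rightarrow> 'w) set \<Rightarrow> bool" where
  "equivalent_monoids smulV smulW M N \<longleftrightarrow>
     (\<exists>f. Vector_Spaces.linear smulV smulW f \<and> bij f \<and> N = {f \<circ> m \<circ> inv f | m. m \<in> M})"

text \<open>Only meaningful when \<open>K\<close> is a line and \<open>L\<close> a hyperplane not containing it.\<close>

definition prj ::
  "('k::field \<Rightarrow> 'v::ab_group_add \<Rightarrow> 'v) \<Rightarrow> 'v set \<Rightarrow> 'v set \<Rightarrow> 'v \<Rightarrow> 'v" where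
  "prj smul K L = (THE p. is_projection smul p \<and> {v. p v = 0} = K \<and> range p = L)"

definition complete_monoid ::
  "('k::field \<Rightarrow> 'v::ab_group_add \<Rightarrow> 'v) \<Rightarrow> 'v set set \<Rightarrow> 'v set set \<Rightarrow> ('v \<Rightarrow> 'v) set" where
  "complete_monoid smul kernels images =
     generated_monoid {prj smul K L | K L. K \<in> kernels \<and> L \<in> images \<and> \<not> K \<subseteq> L}"


section \<open>The dual space\<close>

typedef (overloaded) ('k::field, 'n::finite) dual_vec =
  "{\<phi> :: 'k^'n \<Rightarrow> 'k. Vector_Spaces.linear (*s) (*) \<phi>}"
  morphisms apply_dual Abs_dual
  by (rule exI[of _ "\<lambda>_. 0"]) (auto intro!: Vector_Spaces.linear.intro
      simp: module_hom_iff vec.module_axioms vec.vector_space_axioms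
        vector_space_over_itself.vector_space_axioms vector_space_over_itself.module_axioms)

setup_lifting type_definition_dual_vec

instantiation dual_vec :: (field, finite) ab_group_add
begin

lift_definition zero_dual_vec :: "('a, 'b) dual_vec" is "\<lambda>_. 0"
  by (auto simp: Vector_Spaces.linear_iff vec.vector_space_axioms
      vector_space_over_itself.vector_space_axioms)

lift_definition plus_dual_vec :: "('a, 'b) dual_vec \<Rightarrow> ('a, 'b) dual_vec \<Rightarrow> ('a, 'b) dual_vec"
  is "\<lambda>\<phi> \<psi> v. \<phi> v + \<psi> v"
  by (auto simp: Vector_Spaces.linear_iff algebra_simps)

lift_definition uminus_dual_vec :: "('a, 'b) dual_vec \<Rightarrow> ('a, 'b) dual_vec"
  is "\<lambda>\<phi> v. - \<phi> v"
  by (auto simp: Vector_Spaces.linear_iff)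

lift_definition minus_dual_vec :: "('a, 'b) dual_vec \<Rightarrow> ('a, 'b) dual_vec \<Rightarrow> ('a, 'b) dual_vec"
  is "\<lambda>\<phi> \<psi> v. \<phi> v - \<psi> v"
  by (auto simp: Vector_Spaces.linear_iff algebra_simps)

instance
  by standard (transfer; simp add: fun_eq_iff algebra_simps)+

end

lift_definition dual_scale :: "'k::field \<Rightarrow> ('k, 'n::finite) dual_vec \<Rightarrow> ('k, 'n) dual_vec"
  is "\<lambda>c \<phi> v. c * \<phi> v"
  by (auto simp: Vector_Spaces.linear_iff algebra_simps)

lemma vector_space_dual_scale: "vector_space dual_scale"
  by standard (transfer; simp add: fun_eq_iff algebra_simps)+

text \<open>The dual map of a linear map \<open>m\<close>; \<open>Abs_dual\<close> is unspecified if \<open>m\<close> is not linear.\<close>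

definition dual_map ::
  "('k::field^'n::finite \<Rightarrow> 'k^'n) \<Rightarrow> ('k, 'n) dual_vec \<Rightarrow> ('k, 'n) dual_vec" where
  "dual_map m \<phi> = Abs_dual (apply_dual \<phi> \<circ> m)"

lemma apply_dual_dual_map:
  assumes "Vector_Spaces.linear (*s) (*s) m"
  shows "apply_dual (dual_map m \<phi>) v = apply_dual \<phi> (m v)"
  using assms apply_dual[of \<phi>]
  by (simp add: dual_map_def Abs_dual_inverse Vector_Spaces.linear_compose)

definition dual_monoid ::
  "('k::field^'n::finite \<Rightarrow> 'k^'n) set \<Rightarrow> (('k, 'n) dual_vec \<Rightarrow> ('k, 'n) dual_vec) set" where
  "dual_monoid M = dual_map ` M"


section \<open>The monoids in the classification\<close>

definition root_of_unity :: "complex \<Rightarrow> bool" where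
  "root_of_unity w \<longleftrightarrow> (\<exists>n>0. w ^ n = 1)"

definition primitive_cube_root :: "complex \<Rightarrow> bool" where
  "primitive_cube_root w \<longleftrightarrow> w ^ 3 = 1 \<and> (\<forall>k\<in>{1, 2}. w ^ k \<noteq> 1)"

definition line :: "complex \<Rightarrow> complex \<Rightarrow> (complex^2) set" where
  "line x y = vec.span {vector [x, y]}"

text \<open>In all three families the first argument of \<^const>\<open>complete_monoid\<close> after the scalar
  multiplication lists the kernels and the second one the images.\<close>

definition X_monoid :: "nat \<Rightarrow> complex set \<Rightarrow> (complex^2 \<Rightarrow> complex^2) set" where
  "X_monoid i S = complete_monoid (*s)
     (line 1 ` S \<union>
       (if i = 0 then {} else if i = 1 then {line 1 0} else {line 1 0, line 0 1}))
     {line 1 0, line 0 1}"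

definition Y_monoid :: "complex \<Rightarrow> (complex^2 \<Rightarrow> complex^2) set" where
  "Y_monoid w = complete_monoid (*s)
     {line 1 1, line 0 1, line (1 - w) 1}
     {line 1 1, line 1 0, line 1 (1 + w)}"

text \<open>The parameter \<open>\<omega>\<close> is the fixed primitive cube root of unity; only \<open>i \<le> 5\<close> is meant.\<close>

definition Z_monoid :: "complex \<Rightarrow> nat \<Rightarrow> (complex^2 \<Rightarrow> complex^2) set" where
  "Z_monoid \<omega> i =
     (if i = 5 then
        complete_monoid (*s)
          {line 1 0, line 0 1, line (-1) 1, line \<omega> 1}
          {line 1 0, line 0 1, line (-1) 1, line \<omega> 1}
      else
        complete_monoid (*s)
          ({line 1 0, line 0 1} \<union>
            [{line (-1) 1},
             {line \<omega> 1},
             {line \<omega> 1, line (\<omega>\<^sup>2) 1},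
             {line (-1) 1, line \<omega> 1},
             {line (-1) 1, line \<omega> 1, line (\<omega>\<^sup>2) 1}] ! i)
          {line 1 0, line 0 1, line (-1) 1})"

end

theory Submission
  imports Defs
begin

text \<open>
  In a finite irreducible projection monoid the scalar by which a product of projections differs from
  a projection is a root of unity, so a power of the product removes it. Hence the monoid is complete,
  i.e. determined by its sets of kernels and images, and all cross ratios of two kernels and two images
  are roots of unity. So the monoid becomes a pair of point sets on the projective line, where
  equivalence is the action of projectivities and duality exchanges kernels and images.

  Two images can be moved to \<open>\<infinity>\<close> and \<open>0\<close>, and the remaining kernels are then roots of unity up to a
  common factor. With at least three kernels and three images some point is both a kernel and an image:
  otherwise three kernels would lie on two distinct circles. Moving that point to \<open>\<infinity>\<close> and scaling,
  all nonzero differences between a finite kernel and a finite image are roots of unity. If there is no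
  second common point, the finite points form a unit rhombus, which is the family \<open>Y\<close>; if there is one,
  they are built from unit equilateral triangles, which leaves the monoids \<open>Z\<close>.
\<close>

section \<open>Roots of unity\<close>

lemma root_of_unity_1 [simp]: "root_of_unity 1"
  by (auto simp: root_of_unity_def intro: exI[of _ 1])

lemma root_of_unity_nonzero: "root_of_unity z \<Longrightarrow> z \<noteq> 0"
  by (auto simp: root_of_unity_def zero_power)

lemma root_of_unity_norm:
  assumes "root_of_unity z"
  shows "norm z = 1"
proof -
  obtain n where "n > 0" "norm z ^ n = 1"
    using assms unfolding root_of_unity_def by (metis norm_one norm_power)
  then show ?thesis
    using power_eq_imp_eq_base[of "norm z" n 1] by simp
qed

lemma root_of_unity_mult:
  assumes "root_of_unity z" "root_of_unity w"
  shows "root_of_unity (z * w)"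
proof -
  obtain m n where "m > 0" "n > 0" "z ^ m = 1" "w ^ n = 1"
    using assms by (auto simp: root_of_unity_def)
  moreover have "(z * w) ^ (m * n) = (z ^ m) ^ n * (w ^ n) ^ m"
    by (metis power_mult power_mult_distrib mult.commute)
  ultimately have "m * n > 0" "(z * w) ^ (m * n) = 1"
    by simp_all
  then show ?thesis
    unfolding root_of_unity_def by blast
qed

lemma root_of_unity_inverse: "root_of_unity z \<Longrightarrow> root_of_unity (inverse z)"
  by (auto simp: root_of_unity_def power_inverse)

lemma root_of_unity_minus_iff [simp]: "root_of_unity (- z) \<longleftrightarrow> root_of_unity z"
proof -
  have "root_of_unity (- 1)"
    unfolding root_of_unity_def by (intro exI[of _ 2]) simp
  from root_of_unity_mult[OF this, of z] root_of_unity_mult[OF this, of "- z"]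
  show ?thesis by auto
qed

text \<open>By pigeonhole two powers coincide and can be cancelled. Only positive exponents occur,
  because these are the scalars produced by the powers of a scaled projection.\<close>

lemma root_of_unity_if_finite_powers:
  assumes "finite (range (\<lambda>n. z ^ Suc n))" "z \<noteq> 0"
  shows "root_of_unity z"
proof -
  have "\<not> inj (\<lambda>n. z ^ Suc n)"
    using assms(1) finite_imageD by blast
  then obtain m n where "m < n" "z ^ Suc m = z ^ Suc n"
    by (metis injI linorder_neqE_nat)
  moreover from this have "z ^ Suc n = z ^ Suc m * z ^ (n - m)"
    by (simp flip: power_add)
  ultimately have "z ^ (n - m) = 1" "n - m > 0"
    using assms(2) by auto
  then show ?thesis
    unfolding root_of_unity_def by blast
qed

section \<open>Projections of the plane\<close>

text \<open>The determinant with columns \<open>u\<close> and \<open>v\<close>. For fixed nonzero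
  \<open>u\<close> it is a functional whose kernel is the line of \<open>u\<close>, so projections
  and duality can be written without choosing a basis.\<close>

definition wedge :: "complex^2 \<Rightarrow> complex^2 \<Rightarrow> complex" where
  "wedge u v = u$1 * v$2 - u$2 * v$1"

lemma wedge_simps [simp]:
  "wedge u (v + w) = wedge u v + wedge u w"
  "wedge (u + v) w = wedge u w + wedge v w"
  "wedge u (c *s v) = c * wedge u v"
  "wedge (c *s u) v = c * wedge u v"
  "wedge u (- v) = - wedge u v" "wedge (- u) v = - wedge u v"
  "wedge u u = 0" "wedge u 0 = 0" "wedge 0 u = 0"
  by (simp_all add: wedge_def algebra_simps)

lemma wedge_swap: "wedge u v = - wedge v u"
  by (simp add: wedge_def)

text \<open>Cramer's rule in the plane, with the denominator cleared.\<close>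

lemma wedge_expansion: "wedge u v *s w = wedge w v *s u + wedge u w *s v"
  by (simp add: vec_eq_iff forall_2 wedge_def algebra_simps)

lemma wedge_eq_0:
  assumes "wedge u v = 0" "u \<noteq> 0"
  shows "\<exists>c. v = c *s u"
proof (cases "u$1 = 0")
  case True
  then have "u$2 \<noteq> 0"
    using assms(2) by (auto simp: vec_eq_iff forall_2)
  then show ?thesis
    using assms(1) True by (intro exI[of _ "v$2 / u$2"]) (simp add: vec_eq_iff forall_2 wedge_def)
next
  case False
  then show ?thesis
    using assms(1) by (intro exI[of _ "v$1 / u$1"])
      (auto simp add: vec_eq_iff forall_2 wedge_def field_simps)
qed

lemma linear_determined_by_basis:
  fixes p q :: "complex^2 \<Rightarrow> complex^2"
  assumes "Vector_Spaces.linear (*s) (*s) p" "Vector_Spaces.linear (*s) (*s) q"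
    and "wedge u v \<noteq> 0" "p u = q u" "p v = q v"
  shows "p = q"
proof
  fix w
  have "w = (wedge w v / wedge u v) *s u + (wedge u w / wedge u v) *s v"
    using wedge_expansion[of u v w] assms(3)
    by (simp add: vec_eq_iff forall_2 field_simps)
  moreover have "p (a *s u + b *s v) = q (a *s u + b *s v)" for a b
    using assms by (simp add: Vector_Spaces.linear_iff)
  ultimately show "p w = q w"
    by metis
qed

text \<open>
  A line in the plane is encoded by the quotient \<open>x / y\<close> of its coordinates, \<^term>\<open>None\<close> being the
  value at infinity; so \<open>\<langle>1, s\<rangle>\<close> is \<open>Some (1 / s)\<close>.
\<close>

fun point :: "complex option \<Rightarrow> complex^2" where
  "point None = vector [1, 0]"
| "point (Some z) = vector [z, 1]"

lemma point_nonzero [simp]: "point x \<noteq> 0"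
  by (cases x) (simp_all add: vec_eq_iff forall_2)

lemma point_exists:
  assumes "v \<noteq> 0"
  obtains x c where "c \<noteq> 0" "v = c *s point x"
proof (cases "v$2 = 0")
  case True
  then show ?thesis
    using assms that[of "v$1" None] by (auto simp: vec_eq_iff forall_2)
next
  case False
  then show ?thesis
    using that[of "v$2" "Some (v$1 / v$2)"] by (auto simp: vec_eq_iff forall_2)
qed

text \<open>On finite points this is the difference \<open>z - w\<close>; the determinant extends it
  to infinity, so that cross ratios need no separate limit cases.\<close>

definition gap :: "complex option \<Rightarrow> complex option \<Rightarrow> complex" where
  "gap x y = wedge (point x) (point y)"

lemma gap_simps [simp]:
  "gap None None = 0" "gap None (Some z) = 1" "gap (Some z) None = - 1"
  "gap (Some z) (Some w) = z - w"
  by (simp_all add: gap_def wedge_def)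

lemma gap_eq_0_iff [simp]: "gap x y = 0 \<longleftrightarrow> x = y"
  by (cases x; cases y) auto

text \<open>The functional \<open>wedge (point k)\<close> cuts out the kernel, and dividing by
  \<open>gap k l\<close> makes \<open>point l\<close> a fixed vector. For \<open>k = l\<close> the
  division by zero yields the zero map.\<close>

definition proj :: "complex option \<Rightarrow> complex option \<Rightarrow> complex^2 \<Rightarrow> complex^2" where
  "proj k l v = (wedge (point k) v / gap k l) *s point l"

lemma linear_proj: "Vector_Spaces.linear (*s) (*s) (proj k l)"
  by (simp add: Vector_Spaces.linear_iff vec.vector_space_axioms proj_def
      vec.scale_left_distrib add_divide_distrib)

lemma proj_point [simp]: "proj k l (point m) = (gap k m / gap k l) *s point l"
  by (simp add: proj_def gap_def)

text \<open>The right factor provides the functional and the left factor the image vector, so the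
  product is a multiple of \<open>proj k' l\<close>; the scalar vanishes exactly for
  \<open>k = l'\<close>.\<close>

lemma proj_comp:
  assumes "k \<noteq> l" "k' \<noteq> l'" "k' \<noteq> l"
  shows "proj k l \<circ> proj k' l' =
    (*s) (gap k l' * gap k' l / (gap k l * gap k' l')) \<circ> proj k' l"
  using assms by (simp add: fun_eq_iff proj_def gap_def[symmetric] mult.commute)

lemma proj_zero_iff: "k \<noteq> l \<Longrightarrow> proj k l (point m) = 0 \<longleftrightarrow> m = k"
  by auto

lemma proj_fixes_iff:
  assumes "k \<noteq> l"
  shows "proj k l (point m) = point m \<longleftrightarrow> m = l"
proof
  assume "proj k l (point m) = point m"
  then have "wedge (point m) (proj k l (point m)) = 0"
    by simp
  then have "gap k m * gap m l = 0"
    using assms by (simp add: gap_def[symmetric])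
  moreover have "m \<noteq> k"
    using \<open>proj k l (point m) = point m\<close> by (auto simp: proj_def)
  ultimately show "m = l"
    by auto
qed (use assms in simp)

lemma projection_eq_proj:
  assumes "is_projection (*s) p" "p u = 0" "p v = v" "wedge u v \<noteq> 0"
    "u = c *s point k" "v = d *s point l"
  shows "p = proj k l"
proof (rule linear_determined_by_basis[of _ _ u v])
  have "gap k l \<noteq> 0"
    using assms(4-6) by (auto simp: gap_def)
  then show "p u = proj k l u" "p v = proj k l v"
    using assms(2,3) by (simp_all add: proj_def assms(5,6) gap_def)
qed (use assms linear_proj in \<open>auto simp: is_projection_def\<close>)

lemma is_projection_imp_proj:
  fixes p :: "complex^2 \<Rightarrow> complex^2"
  assumes "is_projection (*s) p"
  obtains k l where "k \<noteq> l" "p = proj k l"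
proof -
  have lin: "Vector_Spaces.linear (*s) (*s) p" and idem: "\<And>v. p (p v) = p v"
    and dim: "vec.dim {v. p v = 0} = 1"
    using assms by (auto simp: is_projection_def fun_eq_iff)
  have "\<not> {v. p v = 0} \<subseteq> {0}"
    using dim by (metis vec.dim_eq_0 zero_neq_one)
  then obtain u where u: "p u = 0" "u \<noteq> 0"
    by auto
  have "{v. p v = 0} \<noteq> UNIV"
    using dim by (auto simp: vec.dim_UNIV card_cart_basis)
  \<comment> \<open>Every value of \<open>p\<close> is fixed by idempotence, and the value at a
    vector outside the kernel is nonzero.\<close>
  then obtain v where v: "p v = v" "v \<noteq> 0"
    using idem by blast
  have "wedge u v \<noteq> 0"
  proof
    assume "wedge u v = 0"
    then obtain c where "v = c *s u"
      using wedge_eq_0 u by blast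
    then have "p v = 0"
      using lin u by (simp add: Vector_Spaces.linear_iff)
    then show False
      using v by simp
  qed
  moreover obtain k c where "u = c *s point k"
    using point_exists u by metis
  moreover obtain l d where "v = d *s point l"
    using point_exists v by metis
  ultimately have "p = proj k l" "k \<noteq> l"
    using projection_eq_proj[OF assms u(1) v(1)] by auto
  then show ?thesis
    using that by blast
qed

lemma kernel_proj: "k \<noteq> l \<Longrightarrow> {v. proj k l v = 0} = vec.span {point k}"
  by (auto simp: proj_def vec.span_singleton dest: wedge_eq_0)

lemma range_proj:
  assumes "k \<noteq> l"
  shows "range (proj k l) = vec.span {point l}"
proof -
  have "proj k l (c *s point l) = c *s point l" for c
    using assms by (simp add: proj_def gap_def[symmetric])
  then have "c *s point l \<in> range (proj k l)" for c
    by (metis rangeI)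
  then show ?thesis
    unfolding vec.span_singleton by (auto simp: proj_def)
qed

lemma is_projection_proj:
  assumes "k \<noteq> l"
  shows "is_projection (*s) (proj k l)"
  using assms linear_proj
  by (auto simp: is_projection_def kernel_proj) (simp add: fun_eq_iff proj_def gap_def[symmetric])

lemma prj_span_point:
  assumes "k \<noteq> l"
  shows "prj (*s) (vec.span {point k}) (vec.span {point l}) = proj k l"
  unfolding prj_def
proof (rule the_equality)
  fix p
  assume p: "is_projection (*s) p \<and> {v. p v = 0} = vec.span {point k} \<and> range p = vec.span {point l}"
  then have "p (point k) = 0" "point l \<in> range p"
    using vec.span_base[of "point k" "{point k}"] vec.span_base[of "point l" "{point l}"] by auto
  moreover from this have "p (point l) = point l"
    using p unfolding is_projection_def fun_eq_iff by (metis comp_apply rangeE)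
  ultimately show "p = proj k l"
    using projection_eq_proj[of p "point k" "point l" 1 k 1 l] p assms
    by (simp flip: gap_def)
qed (use assms in \<open>simp add: is_projection_proj kernel_proj range_proj\<close>)

lemma span_point_subset_iff: "vec.span {point k} \<subseteq> vec.span {point l} \<longleftrightarrow> k = l"
proof
  assume "vec.span {point k} \<subseteq> vec.span {point l}"
  then obtain c where "point k = c *s point l"
    using vec.span_base[of "point k" "{point k}"] by (auto simp: vec.span_singleton)
  then have "gap k l = 0"
    by (simp add: gap_def)
  then show "k = l"
    by simp
qed simp

definition monoid_of :: "complex option set \<Rightarrow> complex option set \<Rightarrow> (complex^2 \<Rightarrow> complex^2) set" where
  "monoid_of A B = generated_monoid {proj k l | k l. k \<in> A \<and> l \<in> B \<and> k \<noteq> l}"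

lemma complete_monoid_eq_monoid_of:
  "complete_monoid (*s) ((\<lambda>k. vec.span {point k}) ` A) ((\<lambda>l. vec.span {point l}) ` B) = monoid_of A B"
proof -
  have "{prj (*s) K L | K L. K \<in> (\<lambda>k. vec.span {point k}) ` A \<and>
      L \<in> (\<lambda>l. vec.span {point l}) ` B \<and> \<not> K \<subseteq> L} =
    {prj (*s) (vec.span {point k}) (vec.span {point l}) | k l. k \<in> A \<and> l \<in> B \<and> k \<noteq> l}"
    using span_point_subset_iff by fast
  also have "\<dots> = {proj k l | k l. k \<in> A \<and> l \<in> B \<and> k \<noteq> l}"
    by (rule Collect_cong) (metis (lifting) prj_span_point)
  finally show ?thesis
    by (simp add: complete_monoid_def monoid_of_def)
qed

section \<open>Generated monoids and equivalence\<close>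

lemma generated_monoid_least:
  assumes "G \<subseteq> M" "id \<in> M" "\<And>a b. a \<in> M \<Longrightarrow> b \<in> M \<Longrightarrow> a \<circ> b \<in> M"
  shows "generated_monoid G \<subseteq> M"
proof
  fix m assume "m \<in> generated_monoid G"
  then show "m \<in> M"
  proof induction
    case (mult a b)
    then show ?case
      using assms(3) by blast
  qed (use assms(1,2) in blast)+
qed

lemma generated_monoid_subset_iff: "generated_monoid G \<subseteq> generated_monoid H \<longleftrightarrow> G \<subseteq> generated_monoid H"
  by (meson generated_monoid.gen generated_monoid.mult generated_monoid.one generated_monoid_least
      subset_iff)

lemma generated_monoid_hom_image:
  assumes "h id = id" "\<And>a b. h (a \<circ> b) = h a \<circ> h b"
  shows "h ` generated_monoid G = generated_monoid (h ` G)"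
proof
  have "m \<in> generated_monoid G \<Longrightarrow> h m \<in> generated_monoid (h ` G)" for m
  proof (induction rule: generated_monoid.induct)
    case one
    show ?case
      unfolding assms(1) by (rule generated_monoid.one)
  next
    case (mult a b)
    then show ?case
      by (metis assms(2) generated_monoid.mult)
  qed (blast intro: generated_monoid.gen)
  then show "h ` generated_monoid G \<subseteq> generated_monoid (h ` G)"
    by blast
  show "generated_monoid (h ` G) \<subseteq> h ` generated_monoid G"
  proof (rule generated_monoid_least)
    show "id \<in> h ` generated_monoid G"
      using assms(1) generated_monoid.one by (metis imageI)
    fix a b assume "a \<in> h ` generated_monoid G" "b \<in> h ` generated_monoid G"
    then obtain a' b' where ab: "a' \<in> generated_monoid G" "b' \<in> generated_monoid G"
      "a = h a'" "b = h b'"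
      by blast
    then have "a \<circ> b = h (a' \<circ> b')"
      by (simp only: assms(2))
    then show "a \<circ> b \<in> h ` generated_monoid G"
      using ab by (blast intro: generated_monoid.mult)
  qed (auto intro: generated_monoid.gen)
qed

text \<open>Reversal of products is assumed only inside the generated monoid: the intended
  \<open>h\<close> is dualisation, which reverses products of linear maps.\<close>

lemma generated_monoid_antihom_image:
  assumes "h id = id"
    and "\<And>a b. a \<in> generated_monoid G \<Longrightarrow> b \<in> generated_monoid G \<Longrightarrow> h (a \<circ> b) = h b \<circ> h a"
  shows "h ` generated_monoid G = generated_monoid (h ` G)"
proof
  have "m \<in> generated_monoid G \<Longrightarrow> h m \<in> generated_monoid (h ` G)" for m
  proof (induction rule: generated_monoid.induct)
    case one
    show ?case
      unfolding assms(1) by (rule generated_monoid.one)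
  next
    case (mult a b)
    then show ?case
      by (metis assms(2) generated_monoid.mult)
  qed (blast intro: generated_monoid.gen)
  then show "h ` generated_monoid G \<subseteq> generated_monoid (h ` G)"
    by blast
  show "generated_monoid (h ` G) \<subseteq> h ` generated_monoid G"
  proof (rule generated_monoid_least)
    show "id \<in> h ` generated_monoid G"
      using assms(1) generated_monoid.one by (metis imageI)
    fix a b assume "a \<in> h ` generated_monoid G" "b \<in> h ` generated_monoid G"
    then obtain a' b' where ab: "a' \<in> generated_monoid G" "b' \<in> generated_monoid G"
      "a = h a'" "b = h b'"
      by blast
    then have "a \<circ> b = h (b' \<circ> a')"
      by (simp only: assms(2))
    then show "a \<circ> b \<in> h ` generated_monoid G"
      using ab by (blast intro: generated_monoid.mult)
  qed (auto intro: generated_monoid.gen)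
qed

lemma conjugate_comp:
  assumes "bij f"
  shows "f \<circ> (a \<circ> b) \<circ> inv f = (f \<circ> a \<circ> inv f) \<circ> (f \<circ> b \<circ> inv f)"
  using assms by (simp add: fun_eq_iff bij_is_inj)

lemma equivalent_monoids_generated:
  assumes "Vector_Spaces.linear s t f" "bij f"
  shows "equivalent_monoids s t (generated_monoid G) (generated_monoid ((\<lambda>m. f \<circ> m \<circ> inv f) ` G))"
proof -
  have "f \<circ> id \<circ> inv f = id"
    using assms(2) by (simp add: fun_eq_iff bij_is_surj surj_f_inv_f)
  then have "(\<lambda>m. f \<circ> m \<circ> inv f) ` generated_monoid G = generated_monoid ((\<lambda>m. f \<circ> m \<circ> inv f) ` G)"
    using conjugate_comp[OF assms(2)] by (rule generated_monoid_hom_image)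
  then show ?thesis
    using assms unfolding equivalent_monoids_def by (blast intro: Setcompr_eq_image[symmetric])
qed

lemma equivalent_monoids_trans:
  assumes "equivalent_monoids s t M N" "equivalent_monoids t u N P"
  shows "equivalent_monoids s u M P"
proof -
  obtain f where f: "Vector_Spaces.linear s t f" "bij f" "N = {f \<circ> m \<circ> inv f | m. m \<in> M}"
    using assms(1) by (auto simp: equivalent_monoids_def)
  obtain g where g: "Vector_Spaces.linear t u g" "bij g" "P = {g \<circ> n \<circ> inv g | n. n \<in> N}"
    using assms(2) by (auto simp: equivalent_monoids_def)
  have "inv (g \<circ> f) = inv f \<circ> inv g"
    using f(2) g(2) by (rule o_inv_distrib[rotated])
  then have "(g \<circ> f) \<circ> m \<circ> inv (g \<circ> f) = g \<circ> (f \<circ> m \<circ> inv f) \<circ> inv g" for m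
    by (simp only: comp_assoc)
  then have "P = {(g \<circ> f) \<circ> m \<circ> inv (g \<circ> f) | m. m \<in> M}"
    unfolding g(3) f(3) by auto
  moreover have "Vector_Spaces.linear s u (g \<circ> f)"
    using f(1) g(1) by (rule Vector_Spaces.linear_compose)
  ultimately show ?thesis
    using bij_comp[OF f(2) g(2)] by (auto simp: equivalent_monoids_def)
qed

section \<open>Completeness and cross ratios\<close>

text \<open>This is the scalar in \<open>proj_comp\<close>. Each of the four points occurs once in
  the numerator and once in the denominator, so rescaling the representing vectors does not change
  it.\<close>

definition cross_ratio ::
  "complex option \<Rightarrow> complex option \<Rightarrow> complex option \<Rightarrow> complex option \<Rightarrow> complex" where
  "cross_ratio k k' l l' = gap k l' * gap k' l / (gap k l * gap k' l')"

text \<open>The third condition is irreducibility: a line \<open>x\<close> is invariant iff every projection has \<open>x\<close> as its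
  kernel or its image.\<close>

definition admissible :: "complex option set \<Rightarrow> complex option set \<Rightarrow> bool" where
  "admissible A B \<longleftrightarrow> finite A \<and> finite B \<and>
     (\<forall>x. \<exists>k\<in>A. \<exists>l\<in>B. k \<noteq> l \<and> k \<noteq> x \<and> l \<noteq> x) \<and>
     (\<forall>k\<in>A. \<forall>k'\<in>A. \<forall>l\<in>B. \<forall>l'\<in>B. {k, k'} \<inter> {l, l'} = {} \<longrightarrow>
        root_of_unity (cross_ratio k k' l l'))"

lemma scaled_proj_in_finite_monoid:
  assumes M: "finite M" "\<And>a b. a \<in> M \<Longrightarrow> b \<in> M \<Longrightarrow> a \<circ> b \<in> M"
    and "(*s) c \<circ> proj k l \<in> M" "c \<noteq> 0" "k \<noteq> l"
  shows "root_of_unity c" "proj k l \<in> M"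
proof -
  have power: "(*s) (c ^ Suc n) \<circ> proj k l \<in> M" for n
  proof (induction n)
    case 0
    show ?case
      using assms(3) by (simp only: power_Suc0_right)
  next
    case (Suc n)
    have "((*s) c \<circ> proj k l) \<circ> ((*s) (c ^ Suc n) \<circ> proj k l) = (*s) (c ^ Suc (Suc n)) \<circ> proj k l"
      using assms(5) by (simp add: fun_eq_iff proj_def gap_def[symmetric] mult_ac)
    then show ?case
      using M(2)[OF assms(3) Suc] by metis
  qed
  \<comment> \<open>Evaluating at \<open>point l\<close> and pairing with \<open>point k\<close>
    recovers the scalar, so the powers of \<open>c\<close> lie in an image of the finite set
    \<open>M\<close>.\<close>
  have "c ^ Suc n = wedge (point k) (((*s) (c ^ Suc n) \<circ> proj k l) (point l)) / gap k l" for n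
    using assms(5) by (simp add: gap_def[symmetric])
  then have "range (\<lambda>n. c ^ Suc n) \<subseteq> (\<lambda>m. wedge (point k) (m (point l)) / gap k l) ` M"
    using power by blast
  then show root: "root_of_unity c"
    using finite_subset[OF _ finite_imageI[OF M(1)]] assms(4)
    by (intro root_of_unity_if_finite_powers)
  then obtain n where "c ^ Suc n = 1"
    unfolding root_of_unity_def by (metis gr0_implies_Suc)
  then show "proj k l \<in> M"
    using power[of n] by (simp only: vec.scale_one[abs_def] flip: id_def) simp
qed

lemma projection_monoid_eq_monoid_of:
  assumes M: "projection_monoid (*s) M" "irreducible_monoid (*s) M" "finite M"
  obtains A B where "M = monoid_of A B" "admissible A B"
proof -
  obtain G where G: "\<forall>g\<in>G. is_projection (*s) g" "M = generated_monoid G"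
    using M(1) by (auto simp: projection_monoid_def)
  \<comment> \<open>Each generator is recorded as its pair of kernel and image. \<open>A\<close> and
    \<open>B\<close> are the two coordinate projections of \<open>R\<close>; \<open>proj_M\<close>
    below shows that kernels and images can be recombined.\<close>
  define R where "R = {(k, l). k \<noteq> l \<and> proj k l \<in> G}"
  define A where "A = fst ` R"
  define B where "B = snd ` R"
  have R: "k \<noteq> l" "proj k l \<in> M" if "(k, l) \<in> R" for k l
    using that by (auto simp: R_def G intro: generated_monoid.gen)
  have comp: "a \<circ> b \<in> M" if "a \<in> M" "b \<in> M" for a b
    using that unfolding G by (rule generated_monoid.mult)
  have G_R: "\<exists>k l. (k, l) \<in> R \<and> g = proj k l" if "g \<in> G" for g
  proof -
    obtain k l where "k \<noteq> l" "g = proj k l"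
      using G(1) \<open>g \<in> G\<close> is_projection_imp_proj by metis
    then show ?thesis
      using \<open>g \<in> G\<close> by (auto simp: R_def)
  qed
  have avoid: "\<exists>k l. (k, l) \<in> R \<and> k \<noteq> x \<and> l \<noteq> x" for x
  proof (rule ccontr)
    assume *: "\<not> ?thesis"
    \<comment> \<open>Every generator now has \<open>x\<close> as its kernel or its image and
      therefore preserves the line of \<open>x\<close>.\<close>
    define W where "W = vec.span {point x}"
    have "g ` W \<subseteq> W" if "g \<in> G" for g
    proof -
      obtain k l where "g = proj k l" "k = x \<or> l = x"
        using G_R \<open>g \<in> G\<close> * by metis
      then show ?thesis
        unfolding W_def vec.span_singleton
        by (auto simp: proj_def intro: exI[of _ 0])
    qed
    then have inv: "generated_monoid G \<subseteq> {m. m ` W \<subseteq> W}"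
      by (intro generated_monoid_least) (auto simp: image_subset_iff)
    have "\<exists>y. y \<noteq> x"
      by (metis option.distinct(1))
    then obtain y where "y \<noteq> x" ..
    then have "point y \<notin> W"
      using span_point_subset_iff[of y x] vec.span_minimal[OF _ vec.subspace_span, of "{point y}" "{point x}"]
      unfolding W_def by auto
    then have "W \<subset> UNIV"
      by auto
    moreover have "vec.subspace W"
      by (simp add: W_def)
    moreover have "\<forall>m\<in>M. m ` W \<subseteq> W"
      using inv unfolding G(2) by blast
    moreover have "point x \<in> W" "0 \<in> W"
      unfolding W_def using vec.span_base[of "point x" "{point x}"] vec.span_zero by blast+
    then have "{0} \<subset> W"
      using point_nonzero[of x] by auto
    ultimately show False
      using M(2) unfolding irreducible_monoid_def by metis
  qed
  have proj_M: "proj k l \<in> M" if "k \<in> A" "l \<in> B" "k \<noteq> l" for k l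
  proof -
    \<comment> \<open>The kernel \<open>k\<close> comes with some image \<open>l'\<close>, and the
      image \<open>l\<close> with some kernel \<open>k'\<close>. The product of the two generators
      has kernel \<open>k\<close> and image \<open>l\<close> unless it vanishes, which happens
      exactly for \<open>k' = l'\<close>.\<close>
    obtain l' k' where kl: "(k, l') \<in> R" "(k', l) \<in> R"
      using \<open>k \<in> A\<close> \<open>l \<in> B\<close> by (auto simp: A_def B_def)
    have "\<exists>c. c \<noteq> 0 \<and> (*s) c \<circ> proj k l \<in> M"
    proof (cases "k' = l'")
      case False
      then have "proj k' l \<circ> proj k l' = (*s) (gap k' l' / (gap k' l * gap k l') * gap k l) \<circ> proj k l"
        using R(1)[OF kl(1)] R(1)[OF kl(2)] that(3) proj_comp[of k' l k l'] by simp
      moreover have "gap k' l' / (gap k' l * gap k l') * gap k l \<noteq> 0"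
        using False R(1)[OF kl(1)] R(1)[OF kl(2)] that(3) by simp
      ultimately show ?thesis
        using comp[OF R(2)[OF kl(2)] R(2)[OF kl(1)]] by metis
    next
      case True
      \<comment> \<open>The direct product vanishes here. A third generator inserted in the middle,
        with kernel and image both different from \<open>l'\<close>, keeps the product
        nonzero.\<close>
      obtain k'' l'' where kl'': "(k'', l'') \<in> R" "k'' \<noteq> l'" "l'' \<noteq> l'"
        using avoid by blast
      define c where "c = gap k' l'' / gap k' l * (gap k'' l' / gap k'' l'') * (gap k l / gap k l')"
      have "proj k' l \<circ> (proj k'' l'' \<circ> proj k l') = (*s) c \<circ> proj k l"
        using that(3) by (simp add: c_def fun_eq_iff proj_def gap_def[symmetric] mult_ac)
      moreover have "c \<noteq> 0"
        using kl'' True that(3) R(1)[OF kl(1)] R(1)[OF kl(2)] R(1)[OF kl''(1)] by (auto simp: c_def)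
      ultimately show ?thesis
        using comp R(2) kl kl''(1) by metis
    qed
    then show ?thesis
      using scaled_proj_in_finite_monoid(2)[OF M(3) comp] \<open>k \<noteq> l\<close> by blast
  qed
  have "M = monoid_of A B"
  proof
    show "M \<subseteq> monoid_of A B"
      unfolding G(2) monoid_of_def generated_monoid_subset_iff
    proof
      fix g assume "g \<in> G"
      then obtain k l where "(k, l) \<in> R" "g = proj k l"
        using G_R by blast
      then have "g \<in> {proj k l |k l. k \<in> A \<and> l \<in> B \<and> k \<noteq> l}"
        using R(1) unfolding A_def B_def by force
      then show "g \<in> generated_monoid {proj k l |k l. k \<in> A \<and> l \<in> B \<and> k \<noteq> l}"
        by (rule generated_monoid.gen)
    qed
    show "monoid_of A B \<subseteq> M"
      unfolding monoid_of_def using proj_M comp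
      by (intro generated_monoid_least) (auto simp: G(2) generated_monoid.one)
  qed
  moreover have "admissible A B"
    unfolding admissible_def
  proof (intro conjI allI ballI impI)
    \<comment> \<open>A kernel is recovered as the only point killed by a projection in
      \<open>M\<close>, so \<open>A\<close> is covered by an image of \<open>M\<close>; the values
      of \<open>THE\<close> at other maps do no harm. Images are recovered in the same way as fixed
      points.\<close>
    have "A \<subseteq> (\<lambda>m. THE x. m (point x) = 0) ` M"
    proof
      fix k assume "k \<in> A"
      then obtain l where "(k, l) \<in> R"
        by (auto simp: A_def)
      then show "k \<in> (\<lambda>m. THE x. m (point x) = 0) ` M"
        using R[of k l] by (intro image_eqI[of _ _ "proj k l"]) (auto simp: proj_zero_iff)
    qed
    then show "finite A"
      using M(3) finite_surj by blast
    have "B \<subseteq> (\<lambda>m. THE x. m (point x) = point x) ` M"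
    proof
      fix l assume "l \<in> B"
      then obtain k where "(k, l) \<in> R"
        by (auto simp: B_def)
      then show "l \<in> (\<lambda>m. THE x. m (point x) = point x) ` M"
        using R[of k l] by (intro image_eqI[of _ _ "proj k l"]) (simp_all add: proj_fixes_iff del: proj_point)
    qed
    then show "finite B"
      using M(3) finite_surj by blast
    show "\<exists>k\<in>A. \<exists>l\<in>B. k \<noteq> l \<and> k \<noteq> x \<and> l \<noteq> x" for x
      using avoid[of x] R(1) unfolding A_def B_def by force
    show "root_of_unity (cross_ratio k k' l l')"
      if "k \<in> A" "k' \<in> A" "l \<in> B" "l' \<in> B" "{k, k'} \<inter> {l, l'} = {}" for k k' l l'
    proof (rule scaled_proj_in_finite_monoid(1)[OF M(3) comp])
      \<comment> \<open>The cross ratio is the scalar by which this product of two projections in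
        \<open>M\<close> differs from a projection.\<close>
      have "(*s) (cross_ratio k k' l l') \<circ> proj k' l = proj k l \<circ> proj k' l'"
        using that(5) unfolding cross_ratio_def by (intro proj_comp[symmetric]) auto
      also have "\<dots> \<in> M"
        using that by (intro comp proj_M) auto
      finally show "(*s) (cross_ratio k k' l l') \<circ> proj k' l \<in> M" .
    qed (use that(5) in \<open>auto simp: cross_ratio_def\<close>)
  qed
  ultimately show ?thesis
    using that by blast
qed

section \<open>Projectivities\<close>

text \<open>These are the Moebius transformations. The scalar \<open>c\<close> compares the image of
  the chosen representative of \<open>x\<close> with the chosen representative of the image
  line.\<close>

definition projectivity :: "(complex option \<Rightarrow> complex option) \<Rightarrow> bool" where
  "projectivity \<sigma> \<longleftrightarrow> bij \<sigma> \<and>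
     (\<exists>g. Vector_Spaces.linear (*s) (*s) g \<and> bij g \<and>
       (\<forall>x. \<exists>c. c \<noteq> 0 \<and> g (point x) = c *s point (\<sigma> x)))"

lemma projectivity_affine:
  assumes "a \<noteq> 0"
  shows "projectivity (map_option (\<lambda>z. a * z + b))"
  unfolding projectivity_def
proof (intro conjI exI allI)
  show "bij (map_option (\<lambda>z. a * z + b))"
    by (rule o_bij[of "map_option (\<lambda>z. (z - b) / a)"])
      (use assms in \<open>simp_all add: fun_eq_iff option.map_comp comp_def option.map_ident\<close>)
  let ?g = "\<lambda>v :: complex^2. vector [a * v$1 + b * v$2, v$2] :: complex^2"
  show "Vector_Spaces.linear (*s) (*s) ?g"
    by (simp add: Vector_Spaces.linear_iff vec.vector_space_axioms vec_eq_iff forall_2 algebra_simps)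
  show "bij ?g"
    by (rule o_bij[of "\<lambda>v. vector [(v$1 - b * v$2) / a, v$2]"])
      (use assms in \<open>simp_all add: fun_eq_iff vec_eq_iff forall_2\<close>)
  show "(if x = None then a else 1) \<noteq> 0"
    and "?g (point x) = (if x = None then a else 1) *s point (map_option (\<lambda>z. a * z + b) x)" for x
    using assms by (cases x; simp add: vec_eq_iff forall_2)+
qed

fun inversion :: "complex option \<Rightarrow> complex option" where
  "inversion None = Some 0"
| "inversion (Some z) = (if z = 0 then None else Some (1 / z))"

lemma projectivity_inversion: "projectivity inversion"
  unfolding projectivity_def
proof (intro conjI exI allI)
  have "inversion (inversion x) = x" for x
    by (cases x) auto
  then show "bij inversion"
    by (intro o_bij[of inversion]) (simp_all add: fun_eq_iff)
  let ?g = "\<lambda>v :: complex^2. vector [v$2, v$1] :: complex^2"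
  show "Vector_Spaces.linear (*s) (*s) ?g"
    by (simp add: Vector_Spaces.linear_iff vec.vector_space_axioms vec_eq_iff forall_2)
  show "bij ?g"
    by (rule o_bij[of ?g]) (simp_all add: fun_eq_iff vec_eq_iff forall_2)
  let ?c = "\<lambda>x. case x of None \<Rightarrow> 1 | Some z \<Rightarrow> if z = 0 then 1 else z"
  show "?c x \<noteq> 0" and "?g (point x) = ?c x *s point (inversion x)" for x
    by (cases x; simp add: vec_eq_iff forall_2)+
qed

text \<open>The constant factor is the determinant of \<open>g\<close>.\<close>

lemma wedge_linear_image:
  assumes "Vector_Spaces.linear (*s) (*s) (g :: complex^2 \<Rightarrow> complex^2)"
  shows "wedge (g u) (g v) = wedge (g (axis 1 1)) (g (axis 2 1)) * wedge u v"
proof -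
  have expand: "g w = w$1 *s g (axis 1 1) + w$2 *s g (axis 2 1)" for w
  proof -
    have "w = w$1 *s axis 1 1 + w$2 *s axis 2 1"
      by (simp add: vec_eq_iff forall_2 axis_def)
    then have "g w = g (w$1 *s axis 1 1 + w$2 *s axis 2 1)"
      by (rule arg_cong)
    also have "\<dots> = w$1 *s g (axis 1 1) + w$2 *s g (axis 2 1)"
      using assms unfolding Vector_Spaces.linear_iff by simp
    finally show ?thesis .
  qed
  show ?thesis
    unfolding expand[of u] expand[of v] by (simp add: wedge_def algebra_simps)
qed

text \<open>A projectivity multiplies \<open>gap x y\<close> by the determinant and divides it by
  one scalar for each of the two points; all of these cancel in the cross ratio.\<close>

lemma cross_ratio_projectivity:
  assumes "projectivity \<sigma>" "{k, k'} \<inter> {l, l'} = {}"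
  shows "cross_ratio (\<sigma> k) (\<sigma> k') (\<sigma> l) (\<sigma> l') = cross_ratio k k' l l'"
proof -
  obtain g where g: "Vector_Spaces.linear (*s) (*s) g" "bij g"
    "\<forall>x. \<exists>c. c \<noteq> 0 \<and> g (point x) = c *s point (\<sigma> x)" and bij: "bij \<sigma>"
    using assms(1) by (auto simp: projectivity_def)
  obtain c where c: "\<And>x. c x \<noteq> 0" "\<And>x. g (point x) = c x *s point (\<sigma> x)"
    using g(3) by metis
  define D where "D = wedge (g (axis 1 1)) (g (axis 2 1))"
  have gap: "gap (\<sigma> x) (\<sigma> y) = D * gap x y / (c x * c y)" for x y
    using wedge_linear_image[OF g(1), of "point x" "point y"] c(1)[of x] c(1)[of y]
    by (simp add: c(2) gap_def D_def field_simps)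
  \<comment> \<open>The determinant is nonzero because infinity and 0 stay distinct under
    \<open>\<sigma>\<close>.\<close>
  have "\<sigma> None \<noteq> \<sigma> (Some 0)"
    using bij by (auto dest: bij_is_inj injD)
  then have "D \<noteq> 0"
    using gap[of None "Some 0"] by auto
  then show ?thesis
    using c(1)[of k] c(1)[of k'] c(1)[of l] c(1)[of l'] by (simp add: cross_ratio_def gap)
qed

lemma admissible_projectivity:
  assumes "projectivity \<sigma>" "admissible A B"
  shows "admissible (\<sigma> ` A) (\<sigma> ` B)"
proof -
  have bij: "bij \<sigma>"
    using assms(1) by (auto simp: projectivity_def)
  then have eq_iff: "\<sigma> x = \<sigma> y \<longleftrightarrow> x = y" for x y
    by (auto dest: bij_is_inj injD)
  have "\<exists>k\<in>A. \<exists>l\<in>B. \<sigma> k \<noteq> \<sigma> l \<and> \<sigma> k \<noteq> x \<and> \<sigma> l \<noteq> x" for x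
  proof -
    obtain y where "x = \<sigma> y"
      using bij by (metis bij_pointE)
    then show ?thesis
      using assms(2) by (simp add: eq_iff admissible_def)
  qed
  then show ?thesis
    using assms(2) by (auto simp: admissible_def eq_iff cross_ratio_projectivity[OF assms(1)])
qed

text \<open>Exchanging kernels and images changes the sign of all four gaps, and the cross ratio
  stays the same.\<close>

lemma admissible_swap:
  assumes "admissible A B"
  shows "admissible B A"
proof -
  have swap: "gap x y = - gap y x" for x y
    by (simp add: gap_def wedge_swap[of "point x"])
  have "cross_ratio l l' k k' = cross_ratio k k' l l'" for k k' l l'
    by (simp add: cross_ratio_def swap[of l] swap[of l'] mult.commute)
  then show ?thesis
    using assms unfolding admissible_def by (metis inf_commute)
qed

text \<open>Conjugation by \<open>g\<close> carries the kernel and the image of a projection to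
  their images under \<open>g\<close>. Both sides are compared on the basis formed by a kernel
  vector and an image vector.\<close>

lemma equivalent_monoids_projectivity:
  assumes "projectivity \<sigma>"
  shows "equivalent_monoids (*s) (*s) (monoid_of A B) (monoid_of (\<sigma> ` A) (\<sigma> ` B))"
proof -
  obtain g where g: "Vector_Spaces.linear (*s) (*s) g" "bij g"
    "\<forall>x. \<exists>c. c \<noteq> 0 \<and> g (point x) = c *s point (\<sigma> x)" and bij: "bij \<sigma>"
    using assms(1) by (auto simp: projectivity_def)
  have eq_iff: "\<sigma> x = \<sigma> y \<longleftrightarrow> x = y" for x y
    using bij by (auto dest: bij_is_inj injD)
  have conj: "g \<circ> proj k l \<circ> inv g = proj (\<sigma> k) (\<sigma> l)" if "k \<noteq> l" for k l
  proof -
    obtain c d where cd: "g (point k) = c *s point (\<sigma> k)" "g (point l) = d *s point (\<sigma> l)"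
      using g(3) by metis
    have "g \<circ> proj k l = proj (\<sigma> k) (\<sigma> l) \<circ> g"
    proof (rule linear_determined_by_basis[of _ _ "point k" "point l"])
      show "(g \<circ> proj k l) (point k) = (proj (\<sigma> k) (\<sigma> l) \<circ> g) (point k)"
        "(g \<circ> proj k l) (point l) = (proj (\<sigma> k) (\<sigma> l) \<circ> g) (point l)"
        using that cd vec.linear_0[OF g(1)]
        by (simp_all add: proj_def gap_def[symmetric] eq_iff)
    qed (use that g(1) linear_proj in \<open>auto simp: gap_def[symmetric] intro: Vector_Spaces.linear_compose\<close>)
    then show ?thesis
      using g(2) by (simp add: fun_eq_iff bij_is_surj surj_f_inv_f)
  qed
  have "(\<lambda>m. g \<circ> m \<circ> inv g) ` {proj k l |k l. k \<in> A \<and> l \<in> B \<and> k \<noteq> l} =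
    (\<lambda>(k, l). g \<circ> proj k l \<circ> inv g) ` {(k, l). k \<in> A \<and> l \<in> B \<and> k \<noteq> l}"
    by auto
  also have "\<dots> = (\<lambda>(k, l). proj (\<sigma> k) (\<sigma> l)) ` {(k, l). k \<in> A \<and> l \<in> B \<and> k \<noteq> l}"
    by (rule image_cong) (auto simp: conj)
  also have "\<dots> = {proj k l |k l. k \<in> \<sigma> ` A \<and> l \<in> \<sigma> ` B \<and> k \<noteq> l}"
    by (auto simp: eq_iff image_def) (metis eq_iff)+
  finally show ?thesis
    using equivalent_monoids_generated[OF g(1,2), of "{proj k l |k l. k \<in> A \<and> l \<in> B \<and> k \<noteq> l}"]
    by (simp only: monoid_of_def)
qed

section \<open>Duality\<close>

lemma linear_generated_monoid:
  assumes "\<forall>g\<in>G. Vector_Spaces.linear (*s) (*s) (g :: complex^2 \<Rightarrow> complex^2)" "m \<in> generated_monoid G"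
  shows "Vector_Spaces.linear (*s) (*s) m"
  using assms(2)
proof induction
  case one
  show ?case
    by (simp add: Vector_Spaces.linear_iff vec.vector_space_axioms)
qed (use assms(1) in \<open>blast intro: Vector_Spaces.linear_compose\<close>)+

text \<open>A functional is identified with a vector spanning its kernel.\<close>

definition dual_coords :: "(complex, 2) dual_vec \<Rightarrow> complex^2" where
  "dual_coords \<phi> = vector [apply_dual \<phi> (vector [0, 1]), - apply_dual \<phi> (vector [1, 0])]"

lemma wedge_dual_coords: "wedge (dual_coords \<phi>) v = apply_dual \<phi> v"
proof -
  have "v = v$1 *s vector [1, 0] + v$2 *s vector [0, 1]"
    by (simp add: vec_eq_iff forall_2)
  then have "apply_dual \<phi> v = apply_dual \<phi> (v$1 *s vector [1, 0] + v$2 *s vector [0, 1])"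
    by simp
  also have "\<dots> = v$1 * apply_dual \<phi> (vector [1, 0]) + v$2 * apply_dual \<phi> (vector [0, 1])"
    using apply_dual[of \<phi>] by (simp add: Vector_Spaces.linear_iff)
  finally show ?thesis
    by (simp add: wedge_def dual_coords_def)
qed

lemma wedge_eqI:
  assumes "\<And>w. wedge u w = wedge v w"
  shows "u = v"
  using assms[of "vector [1, 0]"] assms[of "vector [0, 1]"]
  by (simp add: vec_eq_iff forall_2 wedge_def)

lemma linear_dual_coords: "Vector_Spaces.linear dual_scale (*s) dual_coords"
  unfolding Vector_Spaces.linear_iff
  by (auto simp: vec.vector_space_axioms vector_space_dual_scale wedge_dual_coords
      plus_dual_vec.rep_eq dual_scale.rep_eq intro!: wedge_eqI)

lemma bij_dual_coords: "bij dual_coords"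
proof (rule bijI)
  show "inj dual_coords"
    by (metis injI wedge_dual_coords apply_dual_inject ext)
  have "dual_coords (Abs_dual (wedge v)) = v" for v
  proof (rule wedge_eqI)
    have "Vector_Spaces.linear (*s) (*) (wedge v)"
      by (simp add: Vector_Spaces.linear_iff vec.vector_space_axioms
          vector_space_over_itself.vector_space_axioms)
    then show "wedge (dual_coords (Abs_dual (wedge v))) w = wedge v w" for w
      by (simp add: wedge_dual_coords Abs_dual_inverse)
  qed
  then show "surj dual_coords"
    unfolding surj_def by metis
qed

text \<open>In the coordinates \<open>dual_coords\<close> the dual map becomes the adjoint with
  respect to \<open>wedge\<close>. Taking adjoints reverses products, and by skew symmetry the
  adjoint of \<open>proj k l\<close> is \<open>proj l k\<close>.\<close>

lemma equivalent_monoids_dual: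
  "equivalent_monoids dual_scale (*s) (dual_monoid (monoid_of A B)) (monoid_of B A)"
proof -
  let ?G = "{proj k l |k l. k \<in> A \<and> l \<in> B \<and> k \<noteq> l}"
  define h where "h m = dual_coords \<circ> dual_map m \<circ> inv dual_coords" for m
  have lin: "Vector_Spaces.linear (*s) (*s) m" if "m \<in> generated_monoid ?G" for m
    using that linear_proj by (intro linear_generated_monoid[of ?G]) auto
  have h: "wedge (h m v) w = wedge v (m w)" if "m \<in> generated_monoid ?G" for m v w
    using lin[OF that] bij_dual_coords
    by (simp add: h_def wedge_dual_coords apply_dual_dual_map)
      (metis bij_is_surj surj_f_inv_f wedge_dual_coords)
  have "h ` generated_monoid ?G = generated_monoid (h ` ?G)"
  proof (rule generated_monoid_antihom_image)
    show "h id = id"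
      by (intro ext wedge_eqI) (simp add: h generated_monoid.one)
    show "h (a \<circ> b) = h b \<circ> h a" if "a \<in> generated_monoid ?G" "b \<in> generated_monoid ?G" for a b
      using that by (intro ext wedge_eqI) (simp add: h generated_monoid.mult)
  qed
  also have "h ` ?G = {proj k l |k l. k \<in> B \<and> l \<in> A \<and> k \<noteq> l}"
  proof -
    have "h (proj k l) = proj l k" if "k \<in> A" "l \<in> B" "k \<noteq> l" for k l
    proof (intro ext wedge_eqI)
      have "proj k l \<in> generated_monoid ?G"
        using that by (blast intro: generated_monoid.gen)
      then show "wedge (h (proj k l) v) w = wedge (proj l k v) w" for v w
        by (simp add: h) (simp add: proj_def gap_def wedge_swap[of v] wedge_swap[of "point l" "point k"])
    qed
    then show ?thesis
      by (auto simp: image_def) metis+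
  qed
  finally have "monoid_of B A = h ` monoid_of A B"
    by (simp only: monoid_of_def)
  then have "monoid_of B A = {dual_coords \<circ> m \<circ> inv dual_coords |m. m \<in> dual_monoid (monoid_of A B)}"
    unfolding dual_monoid_def h_def by blast
  then show ?thesis
    unfolding equivalent_monoids_def using linear_dual_coords bij_dual_coords by blast
qed

section \<open>Pairs of point sets\<close>

definition listed :: "complex \<Rightarrow> (complex^2 \<Rightarrow> complex^2) set \<Rightarrow> bool" where
  "listed \<omega> N \<longleftrightarrow>
    (\<exists>i S. i \<in> {0, 1, 2} \<and> finite S \<and> (\<forall>s\<in>S. root_of_unity s) \<and> 1 \<in> S \<and> i + card S \<ge> 2 \<and>
      N = X_monoid i S) \<or>
    (\<exists>w. root_of_unity w \<and> w \<noteq> 1 \<and> w \<noteq> -1 \<and> N = Y_monoid w) \<or>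
    (\<exists>i \<in> {0, 1, 2, 3, 4, 5}. N = Z_monoid \<omega> i)"

text \<open>The pair with \<open>A\<close> and \<open>B\<close> exchanged stands for the dual
  monoid, so that the passage to the dual becomes a symmetry of the condition.\<close>

definition classified :: "complex \<Rightarrow> complex option set \<Rightarrow> complex option set \<Rightarrow> bool" where
  "classified \<omega> A B \<longleftrightarrow> (\<exists>N. listed \<omega> N \<and>
    (equivalent_monoids (*s) (*s) (monoid_of A B) N \<or> equivalent_monoids (*s) (*s) (monoid_of B A) N))"

lemma classified_swap: "classified \<omega> A B \<Longrightarrow> classified \<omega> B A"
  by (auto simp: classified_def)

lemma classified_projectivity:
  assumes "projectivity \<sigma>" "classified \<omega> (\<sigma> ` A) (\<sigma> ` B)"
  shows "classified \<omega> A B"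
  using assms equivalent_monoids_projectivity[OF assms(1)] equivalent_monoids_trans
  unfolding classified_def by meson

lemma classified_listed:
  assumes "listed \<omega> (monoid_of A B)"
  shows "classified \<omega> A B"
proof -
  have "equivalent_monoids (*s) (*s) (monoid_of A B) (monoid_of A B)"
    using equivalent_monoids_projectivity[OF projectivity_affine[of 1 0], of A B]
    by (simp add: option.map_ident)
  then show ?thesis
    using assms unfolding classified_def by blast
qed

lemma line_eq_span_point:
  "y \<noteq> 0 \<Longrightarrow> line x y = vec.span {point (Some (x / y))}"
  "x \<noteq> 0 \<Longrightarrow> line x 0 = vec.span {point None}"
proof -
  have scale: "vec.span {c *s v} = vec.span {v}" if "c \<noteq> 0" for c and v :: "complex^2"
  proof -
    have "c *s v \<in> vec.span {v}"
      by (intro vec.span_scale vec.span_base) simp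
    moreover have "inverse c *s (c *s v) \<in> vec.span {c *s v}"
      by (intro vec.span_scale vec.span_base) simp
    ultimately show ?thesis
      using that by (intro subset_antisym vec.span_minimal) simp_all
  qed
  show "line x y = vec.span {point (Some (x / y))}" if "y \<noteq> 0"
  proof -
    have "vector [x, y] = y *s point (Some (x / y))"
      using that by (simp add: vec_eq_iff forall_2)
    then show ?thesis
      using scale[OF that] by (simp only: line_def)
  qed
  show "line x 0 = vec.span {point None}" if "x \<noteq> 0"
  proof -
    have "vector [x, 0] = x *s point None"
      by (simp add: vec_eq_iff forall_2)
    then show ?thesis
      using scale[OF that] by (simp only: line_def)
  qed
qed

lemma monoid_of_eq_X:
  assumes "0 \<notin> S" "i \<in> {0, 1, 2}"
  shows "monoid_of (Some ` inverse ` S \<union> (if i = 0 then {} else if i = 1 then {None} else {None, Some 0}))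
    {None, Some 0} = X_monoid i S"
proof -
  have "line 1 s = vec.span {point (Some (inverse s))}" if "s \<in> S" for s
  proof -
    have "s \<noteq> 0"
      using assms(1) that by auto
    then show ?thesis
      using line_eq_span_point(1)[of s 1] by (simp add: inverse_eq_divide del: point.simps)
  qed
  then have "line 1 ` S = (\<lambda>k. vec.span {point k}) ` Some ` inverse ` S"
    unfolding image_image by (rule image_cong[OF refl])
  then show ?thesis
    using assms(2) unfolding X_monoid_def complete_monoid_eq_monoid_of[symmetric]
    by (simp add: line_eq_span_point image_Un del: point.simps)
qed

lemma monoid_of_eq_Y:
  assumes "w \<noteq> - 1"
  shows "monoid_of {Some 1, Some 0, Some (1 - w)} {Some 1, None, Some (1 / (1 + w))} = Y_monoid w"
proof -
  have "1 + w \<noteq> 0"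
    using assms by (metis add.inverse_unique)
  then show ?thesis
    unfolding Y_monoid_def complete_monoid_eq_monoid_of[symmetric]
    by (simp add: line_eq_span_point del: point.simps)
qed

text \<open>For configurations in which infinity is both a kernel and an image, so that only the
  finite points remain to be described.\<close>

definition with_infinity :: "complex set \<Rightarrow> complex option set" where
  "with_infinity K = insert None (Some ` K)"

lemma monoid_of_eq_Z:
  assumes "i < 5"
  shows "monoid_of (with_infinity (insert 0
      ([{-1}, {\<omega>}, {\<omega>, \<omega>\<^sup>2}, {-1, \<omega>}, {-1, \<omega>, \<omega>\<^sup>2}] ! i)))
    (with_infinity {0, -1}) = Z_monoid \<omega> i"
proof -
  have "i \<in> {0, 1, 2, 3, 4}"
    using assms by auto
  then show ?thesis
    unfolding Z_monoid_def complete_monoid_eq_monoid_of[symmetric] with_infinity_def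
    by (elim insertE emptyE) (simp_all add: line_eq_span_point insert_commute del: point.simps)
qed

lemma monoid_of_eq_Z5:
  "monoid_of (with_infinity {0, -1, \<omega>}) (with_infinity {0, -1, \<omega>}) = Z_monoid \<omega> 5"
  unfolding Z_monoid_def complete_monoid_eq_monoid_of[symmetric] with_infinity_def
  by (simp add: line_eq_span_point del: point.simps)

section \<open>Moving points to standard position\<close>

lemma projectivity_comp:
  assumes "projectivity \<sigma>" "projectivity \<tau>"
  shows "projectivity (\<tau> \<circ> \<sigma>)"
proof -
  obtain g where g: "Vector_Spaces.linear (*s) (*s) g" "bij g"
    "\<forall>x. \<exists>c. c \<noteq> 0 \<and> g (point x) = c *s point (\<sigma> x)" and "bij \<sigma>"
    using assms(1) by (auto simp: projectivity_def)
  obtain h where h: "Vector_Spaces.linear (*s) (*s) h" "bij h"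
    "\<forall>x. \<exists>c. c \<noteq> 0 \<and> h (point x) = c *s point (\<tau> x)" and "bij \<tau>"
    using assms(2) by (auto simp: projectivity_def)
  have "\<exists>c. c \<noteq> 0 \<and> (h \<circ> g) (point x) = c *s point ((\<tau> \<circ> \<sigma>) x)" for x
  proof -
    obtain c d where "c \<noteq> 0" "g (point x) = c *s point (\<sigma> x)"
      "d \<noteq> 0" "h (point (\<sigma> x)) = d *s point (\<tau> (\<sigma> x))"
      using g(3) h(3) by meson
    moreover have "h (c *s point (\<sigma> x)) = c *s h (point (\<sigma> x))"
      using h(1) unfolding Vector_Spaces.linear_iff by blast
    ultimately show ?thesis
      by (intro exI[of _ "c * d"]) simp
  qed
  moreover have "Vector_Spaces.linear (*s) (*s) (h \<circ> g)"
    using g(1) h(1) by (rule Vector_Spaces.linear_compose)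
  ultimately show ?thesis
    unfolding projectivity_def
    using bij_comp[OF \<open>bij \<sigma>\<close> \<open>bij \<tau>\<close>] bij_comp[OF g(2) h(2)] by blast
qed

lemma projectivity_inj: "projectivity \<sigma> \<Longrightarrow> \<sigma> x = \<sigma> y \<longleftrightarrow> x = y"
  by (auto simp: projectivity_def dest: bij_is_inj injD)

lemma projectivity_to_infinity:
  obtains \<sigma> where "projectivity \<sigma>" "\<sigma> x = None"
proof (cases x)
  case None
  then show ?thesis
    using that[OF projectivity_affine[of 1 0]] by simp
next
  case (Some a)
  then show ?thesis
    using that[OF projectivity_comp[OF projectivity_affine[of 1 "- a"] projectivity_inversion]] by simp
qed

text \<open>Triple transitivity of the Moebius group: once \<open>x\<close> is at infinity, an
  affine map takes the other two points to 0 and 1.\<close>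

lemma projectivity_three_points:
  assumes "distinct [x, y, z]"
  obtains \<sigma> where "projectivity \<sigma>" "\<sigma> x = None" "\<sigma> y = Some 0" "\<sigma> z = Some 1"
proof -
  obtain \<sigma> where \<sigma>: "projectivity \<sigma>" "\<sigma> x = None"
    by (rule projectivity_to_infinity)
  obtain a b where ab: "\<sigma> y = Some a" "\<sigma> z = Some b" "a \<noteq> b"
    using assms projectivity_inj[OF \<sigma>(1)] \<sigma>(2)
    by (metis distinct_length_2_or_more option.exhaust)
  define \<tau> where "\<tau> = map_option (\<lambda>t. (1 / (b - a)) * t + - a / (b - a))"
  have "projectivity (\<tau> \<circ> \<sigma>)"
    unfolding \<tau>_def using ab(3) by (intro projectivity_comp \<sigma>(1) projectivity_affine) simp
  moreover have "(\<tau> \<circ> \<sigma>) x = None" "(\<tau> \<circ> \<sigma>) y = Some 0" "(\<tau> \<circ> \<sigma>) z = Some 1"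
    using ab \<sigma>(2) by (simp_all add: \<tau>_def flip: diff_divide_distrib)
  ultimately show ?thesis
    by (rule that)
qed

section \<open>Two images\<close>

lemma classified_two_images_normalized:
  assumes adm: "admissible A {None, Some 0}" and "Some 1 \<in> A"
  shows "classified \<omega> A {None, Some 0}"
proof -
  have X: "classified \<omega> A {None, Some 0}"
    if adm: "admissible A {None, Some 0}" and "Some 1 \<in> A" and "Some 0 \<in> A \<Longrightarrow> None \<in> A" for A
  proof -
    define T where "T = {z. z \<noteq> 0 \<and> Some z \<in> A}"
    \<comment> \<open>\<open>i\<close> counts the images that are also kernels. The third assumption
      on \<open>A\<close> excludes the kernel 0 without infinity, since \<open>X_monoid 1\<close>
      adds infinity.\<close>
    define i :: nat where "i = (if Some 0 \<in> A then 2 else if None \<in> A then 1 else 0)"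
    have A: "A = Some ` T \<union> (if i = 0 then {} else if i = 1 then {None} else {None, Some 0})"
    proof (rule set_eqI)
      show "x \<in> A \<longleftrightarrow> x \<in> Some ` T \<union> (if i = 0 then {} else if i = 1 then {None} else {None, Some 0})" for x
        using that(3) by (cases x) (auto simp: T_def i_def)
    qed
    have root: "root_of_unity s" if "s \<in> T" for s
    proof -
      \<comment> \<open>With images at infinity and 0 and a kernel at 1, this cross ratio is the
        coordinate \<open>s\<close> itself.\<close>
      have "root_of_unity (cross_ratio (Some s) (Some 1) None (Some 0))"
        using adm \<open>Some 1 \<in> A\<close> \<open>s \<in> T\<close> unfolding admissible_def T_def by auto
      then show ?thesis
        by (simp add: cross_ratio_def)
    qed
    have "finite (Some ` T)"
      using adm A unfolding admissible_def by (metis finite_Un)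
    then have fin: "finite T"
      by (simp add: finite_image_iff)
    have "1 \<in> T"
      using \<open>Some 1 \<in> A\<close> by (simp add: T_def)
    then have card: "i + card T \<ge> 2"
    proof (cases "i = 0")
      case True
      \<comment> \<open>Irreducibility applied to the point 1 provides a second kernel.\<close>
      obtain k where "k \<in> A" "k \<noteq> Some 1"
        using adm unfolding admissible_def by metis
      then obtain t where "t \<in> T" "t \<noteq> 1"
        using A True by auto
      then have "card {1, t} \<le> card T"
        using fin \<open>1 \<in> T\<close> by (intro card_mono) auto
      then show ?thesis
        using \<open>t \<noteq> 1\<close> by simp
    next
      case False
      moreover have "card T > 0"
        using fin \<open>1 \<in> T\<close> by (auto simp: card_gt_0_iff)
      ultimately show ?thesis
        by linarith
    qed
    have inv: "inverse ` inverse ` T = T"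
      by (simp add: image_image)
    have "0 \<notin> inverse ` T"
      by (auto simp: T_def)
    moreover have "i \<in> {0, 1, 2}"
      by (simp add: i_def)
    ultimately have "monoid_of A {None, Some 0} = X_monoid i (inverse ` T)"
      using monoid_of_eq_X[of "inverse ` T" i] unfolding inv A[symmetric] by blast
    moreover have "card (inverse ` T) = card T"
      by (intro card_image inj_onI) simp
    moreover have "1 \<in> inverse ` T"
      using \<open>1 \<in> T\<close> by (intro image_eqI[of _ _ 1]) auto
    ultimately have "listed \<omega> (monoid_of A {None, Some 0})"
      using fin root card \<open>i \<in> {0, 1, 2}\<close> root_of_unity_inverse unfolding listed_def
      by (intro disjI1 exI[of _ i] exI[of _ "inverse ` T"]) auto
    then show ?thesis
      by (rule classified_listed)
  qed
  show ?thesis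
  proof (cases "Some 0 \<in> A \<longrightarrow> None \<in> A")
    case False
    \<comment> \<open>Here 0 is a kernel and infinity is not; inversion exchanges the two images and
      leads back to the case above.\<close>
    have swap: "inversion ` {None, Some 0} = {None, Some 0}"
      by auto
    have "admissible (inversion ` A) {None, Some 0}"
      using admissible_projectivity[OF projectivity_inversion adm] unfolding swap .
    moreover have "Some 1 \<in> inversion ` A"
      using \<open>Some 1 \<in> A\<close> by (intro image_eqI[of _ _ "Some 1"]) auto
    moreover have "None \<in> inversion ` A"
      using False by (intro image_eqI[of _ _ "Some 0"]) auto
    ultimately have "classified \<omega> (inversion ` A) (inversion ` {None, Some 0})"
      unfolding swap by (intro X)
    then show ?thesis
      by (rule classified_projectivity[OF projectivity_inversion])
  qed (use X assms in blast)
qed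

lemma classified_two_images:
  assumes "admissible A B" "B \<subseteq> {x, y}"
  shows "classified \<omega> A B"
proof -
  have avoid: "\<exists>k\<in>A. \<exists>l\<in>B. k \<noteq> l \<and> k \<noteq> p \<and> l \<noteq> p" for p
    using assms(1) by (simp add: admissible_def)
  \<comment> \<open>Irreducibility at \<open>x\<close> forces the image to be \<open>y\<close>, and
    hence the kernel to differ from both.\<close>
  obtain z where z: "z \<in> A" "z \<noteq> x" "z \<noteq> y"
    using avoid[of x] assms(2) by blast
  have B: "B = {x, y}" "x \<noteq> y"
    using avoid[of x] avoid[of y] assms(2) by blast+
  obtain \<sigma> where \<sigma>: "projectivity \<sigma>" "\<sigma> x = None" "\<sigma> y = Some 0" "\<sigma> z = Some 1"
    using projectivity_three_points[of x y z] z B(2) by auto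
  have \<sigma>_B: "\<sigma> ` B = {None, Some 0}"
    using B(1) \<sigma> by simp
  have "admissible (\<sigma> ` A) {None, Some 0}"
    using admissible_projectivity[OF \<sigma>(1) assms(1)] by (simp only: \<sigma>_B)
  moreover have "Some 1 \<in> \<sigma> ` A"
    using z(1) \<sigma>(4) by (metis imageI)
  ultimately have "classified \<omega> (\<sigma> ` A) (\<sigma> ` B)"
    unfolding \<sigma>_B by (rule classified_two_images_normalized)
  then show ?thesis
    by (rule classified_projectivity[OF \<sigma>(1)])
qed

section \<open>Three kernels and three images\<close>

text \<open>Two points with equal distances from 0 and equal distances from 1 are equal or mirror
  images in the real axis, so there are at most two of them.\<close>

lemma two_circles:
  fixes z1 z2 z3 :: complex
  assumes "norm z1 = norm z2" "norm z1 = norm z3"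
    and "norm (z1 - 1) = norm (z2 - 1)" "norm (z1 - 1) = norm (z3 - 1)"
  shows "z1 = z2 \<or> z1 = z3 \<or> z2 = z3"
proof -
  have reflect: "w = z \<or> w = cnj z" if "norm z = norm w" "norm (z - 1) = norm (w - 1)" for z w :: complex
  proof -
    have sq: "(Re z)\<^sup>2 + (Im z)\<^sup>2 = (Re w)\<^sup>2 + (Im w)\<^sup>2"
      using that(1) by (metis cmod_power2)
    moreover have "(Re z - 1)\<^sup>2 + (Im z)\<^sup>2 = (Re w - 1)\<^sup>2 + (Im w)\<^sup>2"
      using that(2) cmod_power2[of "z - 1"] cmod_power2[of "w - 1"] by simp
    ultimately have "Re z = Re w"
      by (simp add: power2_eq_square algebra_simps)
    moreover from this have "(Im z)\<^sup>2 = (Im w)\<^sup>2"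
      using sq by simp
    ultimately show ?thesis
      by (auto simp: complex_eq_iff power2_eq_iff)
  qed
  show ?thesis
    using reflect[of z1 z2] reflect[of z1 z3] assms by auto
qed

lemma admissible_common_point:
  assumes adm: "admissible A B"
    and k: "{k1, k2, k3} \<subseteq> A" "distinct [k1, k2, k3]"
    and l: "{l1, l2, l3} \<subseteq> B" "distinct [l1, l2, l3]"
  shows "A \<inter> B \<noteq> {}"
proof
  assume disj: "A \<inter> B = {}"
  obtain \<sigma> where \<sigma>: "projectivity \<sigma>" "\<sigma> l1 = None" "\<sigma> l2 = Some 0" "\<sigma> l3 = Some 1"
    using l(2) by (rule projectivity_three_points)
  have adm': "admissible (\<sigma> ` A) (\<sigma> ` B)"
    using \<sigma>(1) adm by (rule admissible_projectivity)
  have disj': "\<sigma> ` A \<inter> \<sigma> ` B = {}"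
    using disj projectivity_inj[OF \<sigma>(1)] by auto
  have B': "None \<in> \<sigma> ` B" "Some 0 \<in> \<sigma> ` B" "Some 1 \<in> \<sigma> ` B"
    using l(1) \<sigma> by (metis imageI insert_subset)+
  \<comment> \<open>With the images at infinity, 0 and 1, the cross ratios of two kernels are
    quotients of their distances from 0 and from 1 up to phase; norm one makes these distances
    equal.\<close>
  have norms: "norm z = norm w \<and> norm (z - 1) = norm (w - 1)"
    if "Some z \<in> \<sigma> ` A" "Some w \<in> \<sigma> ` A" for z w
  proof -
    have "z \<noteq> 0" "w \<noteq> 0" "z \<noteq> 1" "w \<noteq> 1"
      using that B' disj' by auto
    then have "root_of_unity (cross_ratio (Some z) (Some w) None (Some 0))"
      "root_of_unity (cross_ratio (Some z) (Some w) None (Some 1))"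
      using adm' that B' unfolding admissible_def by blast+
    then have "root_of_unity (z / w)" "root_of_unity ((1 - z) / (1 - w))"
      by (simp_all add: cross_ratio_def)
    then have "norm z = norm w" "norm (1 - z) = norm (1 - w)"
      using \<open>w \<noteq> 0\<close> \<open>w \<noteq> 1\<close> by (auto dest!: root_of_unity_norm simp: norm_divide)
    then show ?thesis
      by (simp add: norm_minus_commute)
  qed
  have "\<exists>z. \<sigma> x = Some z" if "x \<in> A" for x
    using that B'(1) disj' by (metis disjoint_iff imageI option.exhaust)
  then obtain z1 z2 z3 where z: "\<sigma> k1 = Some z1" "\<sigma> k2 = Some z2" "\<sigma> k3 = Some z3"
    using k(1) by (meson insert_subset)
  then have "Some z1 \<in> \<sigma> ` A" "Some z2 \<in> \<sigma> ` A" "Some z3 \<in> \<sigma> ` A"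
    using k(1) by (metis imageI insert_subset)+
  then have "z1 = z2 \<or> z1 = z3 \<or> z2 = z3"
    using norms two_circles by meson
  then show False
    using k(2) z projectivity_inj[OF \<sigma>(1)] by (metis distinct_length_2_or_more)
qed

section \<open>Infinity as a common point: finite kernels and images at unit distance\<close>

definition unit_differences :: "complex set \<Rightarrow> complex set \<Rightarrow> bool" where
  "unit_differences K L \<longleftrightarrow> (\<forall>k\<in>K. \<forall>l\<in>L. k \<noteq> l \<longrightarrow> root_of_unity (k - l))"

lemma unit_differences_swap: "unit_differences K L \<Longrightarrow> unit_differences L K"
  unfolding unit_differences_def by (metis minus_diff_eq root_of_unity_minus_iff)

lemma unit_differences_affine:
  assumes "unit_differences K L" "root_of_unity a"
  shows "unit_differences ((\<lambda>z. a * z + b) ` K) ((\<lambda>z. a * z + b) ` L)"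
  using assms root_of_unity_mult[OF assms(2)]
  by (auto simp: unit_differences_def simp flip: right_diff_distrib)

lemma classified_affine:
  assumes "a \<noteq> 0"
    and "classified \<omega> (with_infinity ((\<lambda>z. a * z + b) ` K)) (with_infinity ((\<lambda>z. a * z + b) ` L))"
  shows "classified \<omega> (with_infinity K) (with_infinity L)"
proof (rule classified_projectivity[OF projectivity_affine[OF assms(1), of b]])
  have "map_option (\<lambda>z. a * z + b) ` with_infinity K = with_infinity ((\<lambda>z. a * z + b) ` K)" for K
    by (simp add: with_infinity_def image_image)
  then show "classified \<omega> (map_option (\<lambda>z. a * z + b) ` with_infinity K)
    (map_option (\<lambda>z. a * z + b) ` with_infinity L)"
    using assms(2) by simp
qed

text \<open>Inversion exchanges the two common points infinity and 0.\<close>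

lemma classified_inverse:
  assumes "0 \<notin> K" "0 \<notin> L"
    and "classified \<omega> (with_infinity (insert 0 (inverse ` K))) (with_infinity (insert 0 (inverse ` L)))"
  shows "classified \<omega> (with_infinity (insert 0 K)) (with_infinity (insert 0 L))"
proof (rule classified_projectivity[OF projectivity_inversion])
  have "inversion ` with_infinity (insert 0 K) = with_infinity (insert 0 (inverse ` K))" if "0 \<notin> K" for K
  proof -
    have "inversion ` Some ` K = Some ` inverse ` K"
      unfolding image_image using that by (intro image_cong) (auto simp: inverse_eq_divide)
    then show ?thesis
      by (auto simp: with_infinity_def)
  qed
  then show "classified \<omega> (inversion ` with_infinity (insert 0 K)) (inversion ` with_infinity (insert 0 L))"
    using assms by simp
qed

section \<open>A second common point: equilateral triangles\<close>

lemma primitive_cube_root_facts: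
  assumes "primitive_cube_root \<omega>"
  shows "\<omega> \<noteq> 0" "\<omega> ^ 3 = 1" "\<omega> \<noteq> 1" "\<omega>\<^sup>2 = - \<omega> - 1" "inverse \<omega> = \<omega>\<^sup>2" "inverse (\<omega>\<^sup>2) = \<omega>"
proof -
  show cube: "\<omega> ^ 3 = 1" and "\<omega> \<noteq> 1"
    using assms by (auto simp: primitive_cube_root_def)
  then show "\<omega> \<noteq> 0"
    by auto
  have "(\<omega> - 1) * (\<omega>\<^sup>2 + \<omega> + 1) = 0"
    using cube by (simp add: algebra_simps power2_eq_square power3_eq_cube)
  then have "\<omega>\<^sup>2 + (\<omega> + 1) = 0"
    using \<open>\<omega> \<noteq> 1\<close> by (simp add: add.assoc)
  then show "\<omega>\<^sup>2 = - \<omega> - 1"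
    using eq_neg_iff_add_eq_0[of "\<omega>\<^sup>2" "\<omega> + 1"] by simp
  have "\<omega> * \<omega>\<^sup>2 = 1"
    using cube by (simp add: power2_eq_square power3_eq_cube mult.assoc)
  then show "inverse \<omega> = \<omega>\<^sup>2" "inverse (\<omega>\<^sup>2) = \<omega>"
    by (simp_all add: inverse_unique mult.commute)
qed

text \<open>The points 0, 1 and \<open>z\<close> form an equilateral triangle. Eliminating the
  conjugate gives \<open>z * (1 - z) = 1\<close>, whose roots are the primitive sixth roots of
  unity.\<close>

lemma unit_norm_triangle:
  assumes "primitive_cube_root \<omega>" "norm z = 1" "norm (z - 1) = 1"
  shows "z = - \<omega> \<or> z = - \<omega>\<^sup>2"
proof -
  have z: "z * cnj z = 1" "(z - 1) * cnj (z - 1) = 1"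
    using assms(2,3) by (simp_all only: complex_norm_square[symmetric]) simp_all
  have "cnj z = z * cnj z + 1 - z - (z - 1) * cnj (z - 1)"
    by (simp add: algebra_simps)
  then have "cnj z = 1 - z"
    unfolding z by simp
  then have "z * (1 - z) = 1"
    using z(1) by simp
  moreover have "(z + \<omega>) * (z + \<omega>\<^sup>2) = z\<^sup>2 + (\<omega> + \<omega>\<^sup>2) * z + \<omega> ^ 3"
    by (simp add: algebra_simps power2_eq_square power3_eq_cube)
  moreover have "\<omega> + \<omega>\<^sup>2 = -1" "\<omega> ^ 3 = 1"
    using primitive_cube_root_facts[OF assms(1)] by simp_all
  ultimately have "(z + \<omega>) * (z + \<omega>\<^sup>2) = 0"
    by (simp only:) (simp add: algebra_simps power2_eq_square)
  then show ?thesis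
    by (simp add: eq_neg_iff_add_eq_0)
qed

text \<open>Five of the seven possible \<open>K\<close> are listed as they stand. Inversion fixes -1
  and exchanges \<open>\<omega>\<close> with \<open>\<omega>\<^sup>2\<close>, which handles the two
  sets that contain \<open>\<omega>\<^sup>2\<close> but not \<open>\<omega>\<close>.\<close>

lemma classified_three_images:
  assumes \<omega>: "primitive_cube_root \<omega>" and K: "K \<subseteq> {-1, \<omega>, \<omega>\<^sup>2}" "K \<noteq> {}"
  shows "classified \<omega> (with_infinity (insert 0 K)) (with_infinity {0, -1})"
proof -
  note facts = primitive_cube_root_facts[OF \<omega>]
  have Z: "classified \<omega> (with_infinity (insert 0
      ([{-1}, {\<omega>}, {\<omega>, \<omega>\<^sup>2}, {-1, \<omega>}, {-1, \<omega>, \<omega>\<^sup>2}] ! i))) (with_infinity {0, -1})" if "i < 5" for i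
  proof (rule classified_listed)
    have "i \<in> {0, 1, 2, 3, 4, 5}"
      using that by auto
    then show "listed \<omega> (monoid_of (with_infinity (insert 0
      ([{-1}, {\<omega>}, {\<omega>, \<omega>\<^sup>2}, {-1, \<omega>}, {-1, \<omega>, \<omega>\<^sup>2}] ! i))) (with_infinity {0, -1}))"
      unfolding monoid_of_eq_Z[OF that] listed_def by blast
  qed
  have flip: "classified \<omega> (with_infinity (insert 0 K)) (with_infinity {0, -1})"
    if "0 \<notin> K" "classified \<omega> (with_infinity (insert 0 (inverse ` K))) (with_infinity {0, -1})" for K
    using classified_inverse[of K "{-1}" \<omega>] that by simp
  have "K \<in> {{-1}, {\<omega>}, {\<omega>\<^sup>2}, {\<omega>, \<omega>\<^sup>2}, {-1, \<omega>}, {-1, \<omega>\<^sup>2}, {-1, \<omega>, \<omega>\<^sup>2}}"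
    using K by blast
  then show ?thesis
    using Z[of 0] Z[of 1] Z[of 2] Z[of 3] Z[of 4] flip[of "{\<omega>\<^sup>2}"] flip[of "{-1, \<omega>\<^sup>2}"] facts(1,6)
    by (elim insertE emptyE) simp_all
qed

text \<open>If \<open>k\<close> and \<open>l\<close> differ, then 0, \<open>k\<close> and
  \<open>l\<close> have pairwise distance one, and \<open>k / l\<close> is the third vertex of an
  equilateral triangle on 0 and 1.\<close>

lemma unit_differences_neighbours:
  assumes \<omega>: "primitive_cube_root \<omega>"
    and ud: "unit_differences (insert 0 K) (insert 0 L)"
    and "0 \<notin> K" "0 \<notin> L" "k \<in> K" "l \<in> L"
  shows "k = l \<or> k = - \<omega> * l \<or> k = - \<omega>\<^sup>2 * l"
proof (cases "k = l")
  case False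
  have "root_of_unity (k - 0)" "root_of_unity (0 - l)" "root_of_unity (k - l)"
    using assms(2-) False unfolding unit_differences_def by (metis insertCI)+
  then have "norm k = 1" "norm l = 1" "norm (k - l) = 1" "l \<noteq> 0"
    using root_of_unity_norm[of k] root_of_unity_norm[of l] root_of_unity_norm[of "k - l"]
    by auto
  moreover have "k / l - 1 = (k - l) / l"
    using \<open>l \<noteq> 0\<close> by (simp add: field_simps)
  ultimately have "norm (k / l) = 1" "norm (k / l - 1) = 1"
    by (simp_all add: norm_divide)
  then have "k / l = - \<omega> \<or> k / l = - \<omega>\<^sup>2"
    by (rule unit_norm_triangle[OF \<omega>])
  then show ?thesis
    using \<open>l \<noteq> 0\<close> by (auto simp: field_simps)
qed simp

text \<open>The factor is \<open>- inverse l\<close>; the target -1 is the nonzero finite image in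
  the monoids \<open>Z\<close> with three images.\<close>

lemma unit_differences_rescale:
  assumes "unit_differences (insert 0 K) (insert 0 L)" "l \<in> L" "0 \<notin> L"
  obtains a where "root_of_unity a" "a \<noteq> 0" "a * l = -1"
    "unit_differences (insert 0 ((*) a ` K)) (insert 0 ((*) a ` L))"
proof
  have "root_of_unity l"
    using assms unfolding unit_differences_def by (metis diff_0 insertCI root_of_unity_minus_iff)
  then show root: "root_of_unity (- inverse l)"
    by (simp add: root_of_unity_inverse)
  show "- inverse l * l = -1" "- inverse l \<noteq> 0"
    using \<open>root_of_unity l\<close> root_of_unity_nonzero by auto
  show "unit_differences (insert 0 ((*) (- inverse l) ` K)) (insert 0 ((*) (- inverse l) ` L))"
    using unit_differences_affine[OF assms(1) root, of 0] by simp
qed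

lemma classified_scale:
  assumes "a \<noteq> 0"
    and "classified \<omega> (with_infinity (insert 0 ((*) a ` K))) (with_infinity (insert 0 ((*) a ` L)))"
  shows "classified \<omega> (with_infinity (insert 0 K)) (with_infinity (insert 0 L))"
  using classified_affine[OF assms(1), of \<omega> 0 "insert 0 K" "insert 0 L"] assms(2) by simp

lemma classified_one_nonzero_image:
  assumes \<omega>: "primitive_cube_root \<omega>"
    and ud: "unit_differences (insert 0 K) {0, l}" and "0 \<notin> K" "K \<noteq> {}" "l \<noteq> 0"
  shows "classified \<omega> (with_infinity (insert 0 K)) (with_infinity {0, l})"
proof -
  obtain a where a: "root_of_unity a" "a \<noteq> 0" "a * l = -1"
    and ud': "unit_differences (insert 0 ((*) a ` K)) (insert 0 ((*) a ` {l}))"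
    using unit_differences_rescale[OF ud] \<open>l \<noteq> 0\<close> by auto
  have "0 \<notin> (*) a ` K"
    using a(2) \<open>0 \<notin> K\<close> by auto
  then have "k \<in> {-1, \<omega>, \<omega>\<^sup>2}" if "k \<in> (*) a ` K" for k
    using unit_differences_neighbours[OF \<omega> ud' _ _ that, of "-1"] a(3) by auto
  then have "classified \<omega> (with_infinity (insert 0 ((*) a ` K))) (with_infinity {0, -1})"
    using \<open>K \<noteq> {}\<close> by (intro classified_three_images[OF \<omega>]) auto
  then show ?thesis
    using classified_scale[OF a(2), of \<omega> K "{l}"] a(3) by simp
qed

lemma two_element_subset: "S \<subseteq> {a, b} \<Longrightarrow> x \<in> S \<Longrightarrow> y \<in> S \<Longrightarrow> x \<noteq> y \<Longrightarrow> S = {a, b}"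
  by auto

lemma classified_common_zero:
  assumes \<omega>: "primitive_cube_root \<omega>"
    and ud: "unit_differences (insert 0 K) (insert 0 L)"
    and K: "0 \<notin> K" "K \<noteq> {}" and L: "0 \<notin> L" "L \<noteq> {}"
  shows "classified \<omega> (with_infinity (insert 0 K)) (with_infinity (insert 0 L))"
proof (cases "(\<exists>l. L = {l}) \<or> (\<exists>k. K = {k})")
  case True
  then show ?thesis
    using classified_one_nonzero_image[OF \<omega>] unit_differences_swap[OF ud] ud K L
    by (auto intro: classified_swap)
next
  case False
  note facts = primitive_cube_root_facts[OF \<omega>]
  obtain k1 k2 l1 l2 where two: "k1 \<in> K" "k2 \<in> K" "k1 \<noteq> k2" "l1 \<in> L" "l2 \<in> L" "l1 \<noteq> l2"
    using False K(2) L(2) by (metis is_singletonI' is_singleton_the_elem)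
  obtain a where a: "root_of_unity a" "a \<noteq> 0" "a * l1 = -1"
    and ud': "unit_differences (insert 0 ((*) a ` K)) (insert 0 ((*) a ` L))"
    using unit_differences_rescale[OF ud two(4) L(1)] by blast
  define K' where "K' = (*) a ` K"
  define L' where "L' = (*) a ` L"
  have zero: "0 \<notin> K'" "0 \<notin> L'"
    using \<open>a \<noteq> 0\<close> K L by (auto simp: K'_def L'_def)
  have in_L': "-1 \<in> L'" "a * l2 \<in> L'" "-1 \<noteq> a * l2"
    using two a unfolding L'_def by (metis imageI mult_left_cancel)+
  have in_K': "a * k1 \<in> K'" "a * k2 \<in> K'" "a * k1 \<noteq> a * k2"
    using two a unfolding K'_def by simp_all
  \<comment> \<open>The roles of kernels and images are exchanged here: each kernel restricts the
    position of every image.\<close>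
  have nb: "l = k \<or> l = - \<omega> * k \<or> l = - \<omega>\<^sup>2 * k" if "k \<in> K'" "l \<in> L'" for k l
    using unit_differences_neighbours[OF \<omega> unit_differences_swap[OF ud'] zero(2,1)[unfolded K'_def L'_def]]
      that by (simp add: K'_def L'_def)
  have products: "\<omega> * \<omega> = \<omega>\<^sup>2" "\<omega> * \<omega>\<^sup>2 = 1" "\<omega>\<^sup>2 * \<omega> = 1" "\<omega>\<^sup>2 * \<omega>\<^sup>2 = \<omega>"
  proof -
    show "\<omega> * \<omega> = \<omega>\<^sup>2" "\<omega> * \<omega>\<^sup>2 = 1" "\<omega>\<^sup>2 * \<omega> = 1"
      using facts(2) by (simp_all add: power2_eq_square power3_eq_cube mult.assoc)
    then show "\<omega>\<^sup>2 * \<omega>\<^sup>2 = \<omega>"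
      by (metis mult.assoc mult_1_right power2_eq_square)
  qed
  have distinct: "\<omega> \<noteq> \<omega>\<^sup>2" "\<omega> \<noteq> - \<omega>" "\<omega>\<^sup>2 \<noteq> - \<omega>\<^sup>2" "- \<omega>\<^sup>2 \<noteq> - \<omega>"
    using facts(1,3) by (auto simp: power2_eq_square)
  have K'_sub: "k \<in> {-1, \<omega>, \<omega>\<^sup>2}" if "k \<in> K'" for k
    using unit_differences_neighbours[OF \<omega> ud' zero[unfolded K'_def L'_def], of k "-1"]
      that in_L'(1) by (simp add: K'_def L'_def)
  have near_minus_1: "l \<in> {-1, \<omega>, \<omega>\<^sup>2}" if "-1 \<in> K'" "l \<in> L'" for l
    using nb[OF that] by auto
  have near_\<omega>: "l \<in> {\<omega>, - \<omega>\<^sup>2, -1}" if "\<omega> \<in> K'" "l \<in> L'" for l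
    using nb[OF that] by (simp only: mult_minus_left products insert_iff empty_iff) blast
  have near_\<omega>2: "l \<in> {\<omega>\<^sup>2, -1, - \<omega>}" if "\<omega>\<^sup>2 \<in> K'" "l \<in> L'" for l
    using nb[OF that] by (simp only: mult_minus_left products insert_iff empty_iff) blast
  \<comment> \<open>If both were kernels, the two lists of admissible images would share only -1,
    but \<open>L'\<close> has a second element.\<close>
  have "\<not> (\<omega> \<in> K' \<and> \<omega>\<^sup>2 \<in> K')"
    using near_\<omega>[OF _ in_L'(2)] near_\<omega>2[OF _ in_L'(2)] in_L'(3) distinct by fastforce
  then consider "K' \<subseteq> {-1, \<omega>}" | "K' \<subseteq> {-1, \<omega>\<^sup>2}"
    using K'_sub by blast
  then consider "K' = {-1, \<omega>}" | "K' = {-1, \<omega>\<^sup>2}"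
    using two_element_subset[OF _ in_K'] by metis
  then have "classified \<omega> (with_infinity (insert 0 K')) (with_infinity (insert 0 L'))"
  proof cases
    case 1
    \<comment> \<open>The images must lie near both kernels, and the two lists meet in -1 and
      \<open>\<omega>\<close> only. The resulting symmetric configuration is that of
      \<open>Z_monoid \<omega> 5\<close>.\<close>
    then have "L' \<subseteq> {-1, \<omega>}"
      using near_minus_1 near_\<omega> distinct by fastforce
    then have "L' = {-1, \<omega>}"
      by (rule two_element_subset[OF _ in_L'])
    then show ?thesis
      using classified_listed[of \<omega> "with_infinity {0, -1, \<omega>}" "with_infinity {0, -1, \<omega>}"] 1
      by (simp add: monoid_of_eq_Z5 listed_def)
  next
    case 2
    then have "L' \<subseteq> {-1, \<omega>\<^sup>2}"
      using near_minus_1 near_\<omega>2 distinct by fastforce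
    then have "L' = {-1, \<omega>\<^sup>2}"
      by (rule two_element_subset[OF _ in_L'])
    \<comment> \<open>Inversion turns this configuration into the one of the first case.\<close>
    then show ?thesis
      using classified_inverse[OF zero, of \<omega>] 2 facts(6)
        classified_listed[of \<omega> "with_infinity {0, -1, \<omega>}" "with_infinity {0, -1, \<omega>}"]
      by (simp add: monoid_of_eq_Z5 listed_def)
  qed
  then show ?thesis
    unfolding K'_def L'_def by (rule classified_scale[OF a(2)])
qed

section \<open>No second common point: the unit rhombus\<close>

text \<open>The unit circles about 1 and \<open>u\<close> meet only in 0 and \<open>1 + u\<close>.
  Algebraically, subtracting the two circle equations gives \<open>cnj l = l * cnj u\<close>, and
  substituting this back determines \<open>l\<close>.\<close>

lemma rhombus_fourth_vertex:
  fixes u l :: complex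
  assumes "norm u = 1" "u \<noteq> 1" "norm (l - 1) = 1" "norm (l - u) = 1" "l \<noteq> 0"
  shows "l = 1 + u"
proof -
  have u: "u * cnj u = 1" and l: "(l - 1) * cnj (l - 1) = 1" "(l - u) * cnj (l - u) = 1"
    using assms by (simp_all only: complex_norm_square[symmetric]) simp_all
  have "l * cnj l = l + cnj l"
    using l(1) by (simp add: algebra_simps)
  moreover have "l * cnj l = l * cnj u + u * cnj l"
    using l(2) u by (simp add: algebra_simps)
  ultimately have "l * (1 - cnj u) = (u - 1) * cnj l"
    by (simp add: algebra_simps)
  moreover have "1 - cnj u = (u - 1) * cnj u"
    using u by (simp add: algebra_simps)
  ultimately have "(u - 1) * (l * cnj u) = (u - 1) * cnj l"
    by (simp add: mult_ac)
  then have "cnj l = l * cnj u"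
    using assms(2) by simp
  then have "l * (l * cnj u) = l * (1 + cnj u)"
    using \<open>l * cnj l = l + cnj l\<close> by (simp add: algebra_simps)
  then have "l * cnj u = 1 + cnj u"
    using assms(5) by simp
  then have "u * (l * cnj u) = u * (1 + cnj u)"
    by simp
  then have "l * (u * cnj u) = u + u * cnj u"
    by (simp add: algebra_simps)
  then show ?thesis
    using u by simp
qed

lemma classified_rhombus:
  assumes "root_of_unity u" "u \<noteq> 1" "u \<noteq> -1"
  shows "classified \<omega> (with_infinity {1, u}) (with_infinity {0, 1 + u})"
proof -
  define w where "w = inverse u"
  have "u \<noteq> 0"
    using assms(1) root_of_unity_nonzero by blast
  have "1 + u \<noteq> 0"
    using assms(3) by (metis add.inverse_unique)
  have w: "root_of_unity w" "w \<noteq> 1" "w \<noteq> -1"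
    using assms root_of_unity_inverse unfolding w_def
    by (auto simp: inverse_eq_iff_eq) (metis inverse_inverse_eq inverse_minus_eq inverse_1)
  \<comment> \<open>The map \<open>1 - 1 / z\<close> sends the kernels infinity, 1, \<open>u\<close>
    to 1, 0, \<open>1 - w\<close> and the images infinity, 0, \<open>1 + u\<close> to 1, infinity,
    \<open>1 / (1 + w)\<close>.\<close>
  let ?\<sigma> = "map_option (\<lambda>z. -1 * z + 1) \<circ> inversion"
  have "?\<sigma> ` with_infinity {1, u} = {Some 1, Some 0, Some (1 - w)}"
    using \<open>u \<noteq> 0\<close> by (simp add: with_infinity_def w_def inverse_eq_divide)
  moreover have "1 - 1 / (1 + u) = 1 / (1 + w)"
    using \<open>u \<noteq> 0\<close> \<open>1 + u \<noteq> 0\<close> by (simp add: w_def field_simps)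
  then have "?\<sigma> ` with_infinity {0, 1 + u} = {Some 1, None, Some (1 / (1 + w))}"
    using \<open>1 + u \<noteq> 0\<close> by (simp add: with_infinity_def)
  moreover have "listed \<omega> (monoid_of {Some 1, Some 0, Some (1 - w)} {Some 1, None, Some (1 / (1 + w))})"
    unfolding monoid_of_eq_Y[OF w(3)] listed_def using w by blast
  ultimately have "classified \<omega> (?\<sigma> ` with_infinity {1, u}) (?\<sigma> ` with_infinity {0, 1 + u})"
    by (simp only: classified_listed)
  moreover have "projectivity ?\<sigma>"
    by (intro projectivity_comp projectivity_inversion projectivity_affine) simp
  ultimately show ?thesis
    by (rule classified_projectivity[rotated])
qed

text \<open>Any kernel \<open>k\<close> other than 1 and any image \<open>l\<close> other than 0
  satisfy \<open>l = 1 + k\<close>. Fixing one of them determines the other, so there is just one of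
  each.\<close>

lemma classified_disjoint_normalized:
  assumes ud: "unit_differences K L" and disj: "K \<inter> L = {}" and "1 \<in> K" "0 \<in> L"
    and K: "K \<noteq> {1}" and L: "L \<noteq> {0}"
  shows "classified \<omega> (with_infinity K) (with_infinity L)"
proof -
  have root: "root_of_unity (k - l)" if "k \<in> K" "l \<in> L" for k l
  proof -
    have "k \<noteq> l"
      using disj that by auto
    then show ?thesis
      using ud that by (simp add: unit_differences_def)
  qed
  have vertex: "l = 1 + k" if "k \<in> K" "k \<noteq> 1" "l \<in> L" "l \<noteq> 0" for k l
  proof (rule rhombus_fourth_vertex)
    show "norm k = 1" "norm (l - 1) = 1" "norm (l - k) = 1"
      using root[of k 0] root[of 1 l] root[of k l] that assms(3,4)
      by (simp_all add: root_of_unity_norm norm_minus_commute)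
  qed (use that in simp_all)
  obtain u where u: "u \<in> K" "u \<noteq> 1"
    using \<open>1 \<in> K\<close> K by blast
  obtain l where l: "l \<in> L" "l \<noteq> 0"
    using \<open>0 \<in> L\<close> L by blast
  have "l = 1 + u"
    using vertex u l by blast
  have "L = {0, 1 + u}"
    using vertex[OF u] \<open>0 \<in> L\<close> l \<open>l = 1 + u\<close> by blast
  moreover have "k \<in> {1, u}" if "k \<in> K" for k
  proof (cases "k = 1")
    case False
    have "1 + u = 1 + k"
      using vertex[OF that False l] \<open>l = 1 + u\<close> by metis
    then show ?thesis
      by simp
  qed simp
  then have "K = {1, u}"
    using \<open>1 \<in> K\<close> u(1) by blast
  moreover have "u \<noteq> -1"
    using l(2) \<open>l = 1 + u\<close> by auto
  ultimately show ?thesis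
    using classified_rhombus root[OF u(1) \<open>0 \<in> L\<close>] u(2) by simp
qed

lemma classified_unit_differences:
  assumes \<omega>: "primitive_cube_root \<omega>" and ud: "unit_differences K L"
    and K: "k1 \<in> K" "k2 \<in> K" "k1 \<noteq> k2" and L: "l1 \<in> L" "l2 \<in> L" "l1 \<noteq> l2"
  shows "classified \<omega> (with_infinity K) (with_infinity L)"
proof (cases "K \<inter> L = {}")
  case True
  \<comment> \<open>The affine map \<open>f\<close> takes \<open>k1\<close> to 1 and
    \<open>l1\<close> to 0; its factor is a root of unity, so unit differences are
    preserved.\<close>
  define a where "a = inverse (k1 - l1)"
  define f where "f = (\<lambda>z. a * z + - a * l1)"
  have "k1 \<noteq> l1"
    using True K L by blast
  then have a: "root_of_unity a" "a \<noteq> 0"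
    using ud K(1) L(1) root_of_unity_inverse unfolding unit_differences_def a_def by auto
  have f_eq: "f x = f y \<longleftrightarrow> x = y" for x y
    using a(2) by (simp add: f_def)
  have f_values: "f k1 = 1" "f l1 = 0"
    using \<open>k1 \<noteq> l1\<close> by (simp_all add: f_def a_def flip: right_diff_distrib)
  have "classified \<omega> (with_infinity (f ` K)) (with_infinity (f ` L))"
  proof (rule classified_disjoint_normalized)
    show "unit_differences (f ` K) (f ` L)"
      using unit_differences_affine[OF ud a(1)] by (simp only: f_def)
    show "f ` K \<inter> f ` L = {}"
      using True by (auto simp: f_eq)
    show "1 \<in> f ` K" "0 \<in> f ` L"
      using f_values K(1) L(1) by (metis imageI)+
    have "f k2 \<noteq> 1" "f l2 \<noteq> 0"
      using f_values f_eq K(3) L(3) by metis+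
    then show "f ` K \<noteq> {1}" "f ` L \<noteq> {0}"
      using K(2) L(2) by blast+
  qed
  then show ?thesis
    unfolding f_def by (rule classified_affine[OF a(2)])
next
  case False
  then obtain p where p: "p \<in> K" "p \<in> L"
    by blast
  \<comment> \<open>A translation moves the common point \<open>p\<close> to 0; it is written in the
    affine form of \<open>unit_differences_affine\<close>.\<close>
  define f where "f = (\<lambda>z. 1 * z + - p)"
  have f_eq: "f x = 0 \<longleftrightarrow> x = p" for x
    by (auto simp: f_def)
  have insert: "f ` M = insert 0 (f ` (M - {p}))" if "p \<in> M" for M
    using that f_eq by (metis image_insert insert_Diff)
  have "unit_differences (f ` K) (f ` L)"
    unfolding f_def by (rule unit_differences_affine[OF ud]) simp
  moreover have "K - {p} \<noteq> {}" "L - {p} \<noteq> {}"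
    using K L by blast+
  moreover have "0 \<notin> f ` (M - {p})" for M
    using f_eq by fastforce
  ultimately have "classified \<omega> (with_infinity (f ` K)) (with_infinity (f ` L))"
    unfolding insert[OF p(1)] insert[OF p(2)] by (intro classified_common_zero[OF \<omega>]) auto
  then show ?thesis
    unfolding f_def by (rule classified_affine[rotated]) simp
qed

section \<open>Reduction of the general case\<close>

text \<open>A cross ratio that involves infinity is a quotient of two differences sharing an end
  point. Chaining such quotients compares every difference with the fixed one
  \<open>k0 - l0\<close>.\<close>

lemma scaled_unit_differences:
  assumes adm: "admissible (with_infinity K) (with_infinity L)"
  obtains c where "c \<noteq> 0" "\<And>k l. k \<in> K \<Longrightarrow> l \<in> L \<Longrightarrow> k \<noteq> l \<Longrightarrow> root_of_unity ((k - l) / c)"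
proof -
  have in_iff: "Some z \<in> with_infinity M \<longleftrightarrow> z \<in> M" "None \<in> with_infinity M" for z M
    by (auto simp: with_infinity_def)
  have kernels: "root_of_unity ((k - l) / (k' - l))"
    if "k \<in> K" "k' \<in> K" "l \<in> L" "k \<noteq> l" "k' \<noteq> l" for k k' l
  proof -
    have "root_of_unity (cross_ratio (Some k') (Some k) (Some l) None)"
      using adm that in_iff unfolding admissible_def by auto
    moreover have "(k - l) / (k' - l) = (l - k) / (l - k')"
      by (metis minus_diff_eq minus_divide_divide)
    ultimately show ?thesis
      by (simp add: cross_ratio_def)
  qed
  have images: "root_of_unity ((k - l) / (k - l'))"
    if "k \<in> K" "l \<in> L" "l' \<in> L" "k \<noteq> l" "k \<noteq> l'" for k l l'
  proof -
    have "root_of_unity (cross_ratio None (Some k) (Some l) (Some l'))"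
      using adm that in_iff unfolding admissible_def by auto
    then show ?thesis
      by (simp add: cross_ratio_def)
  qed
  obtain x y where "x \<in> with_infinity K" "y \<in> with_infinity L" "x \<noteq> y" "x \<noteq> None" "y \<noteq> None"
    using adm unfolding admissible_def by meson
  then obtain k0 l0 where base: "k0 \<in> K" "l0 \<in> L" "k0 \<noteq> l0"
    by (auto simp: with_infinity_def)
  have "root_of_unity ((k - l) / (k0 - l0))" if kl: "k \<in> K" "l \<in> L" "k \<noteq> l" for k l
  proof -
    \<comment> \<open>The chain passes through \<open>k0 - l\<close> or \<open>k - l0\<close>. If
      both of these vanish, the two differences are negatives of each other.\<close>
    consider "k0 \<noteq> l" | "k \<noteq> l0" | "k0 = l" "k = l0"
      by blast
    then show ?thesis
    proof cases
      case 1
      then have "root_of_unity ((k - l) / (k0 - l) * ((k0 - l) / (k0 - l0)))"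
        using kl base by (intro root_of_unity_mult kernels images) auto
      then show ?thesis
        using 1 by simp
    next
      case 2
      then have "root_of_unity ((k - l) / (k - l0) * ((k - l0) / (k0 - l0)))"
        using kl base by (intro root_of_unity_mult kernels images) auto
      then show ?thesis
        using 2 by simp
    next
      case 3
      then have "(k - l) / (k0 - l0) = - 1"
        using kl by (simp add: field_simps)
      then show ?thesis
        by simp
    qed
  qed
  then show ?thesis
    using that[of "k0 - l0"] base(3) by simp
qed

lemma subset_pair_or_three:
  obtains x y where "A \<subseteq> {x, y}" | x y z where "{x, y, z} \<subseteq> A" "distinct [x, y, z]"
proof (cases "\<exists>x y. A \<subseteq> {x, y}")
  case False
  then obtain x where "x \<in> A"
    by blast
  moreover obtain y where "y \<in> A" "y \<noteq> x"
    using False by blast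
  moreover obtain z where "z \<in> A" "z \<noteq> x" "z \<noteq> y"
    using False by blast
  ultimately show ?thesis
    using that(2)[of x y z] by auto
qed (use that in blast)

lemma classified_admissible:
  assumes \<omega>: "primitive_cube_root \<omega>" and adm: "admissible A B"
  shows "classified \<omega> A B"
proof (cases rule: subset_pair_or_three[of B])
  case (1 x y)
  then show ?thesis
    using classified_two_images[OF adm] by blast
next
  case l: (2 l1 l2 l3)
  show ?thesis
  proof (cases rule: subset_pair_or_three[of A])
    case (1 x y)
    then show ?thesis
      using classified_two_images[OF admissible_swap[OF adm]] classified_swap by blast
  next
    case k: (2 k1 k2 k3)
    obtain x where x: "x \<in> A" "x \<in> B"
      using admissible_common_point[OF adm k l] by blast
    obtain \<sigma> where \<sigma>: "projectivity \<sigma>" "\<sigma> x = None"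
      by (rule projectivity_to_infinity)
    have \<sigma>_eq: "\<sigma> y = \<sigma> z \<longleftrightarrow> y = z" for y z
      by (rule projectivity_inj[OF \<sigma>(1)])
    define K where "K = {z. Some z \<in> \<sigma> ` A}"
    define L where "L = {z. Some z \<in> \<sigma> ` B}"
    have split: "C = with_infinity {z. Some z \<in> C}" if "None \<in> C" for C
    proof (rule set_eqI)
      show "y \<in> C \<longleftrightarrow> y \<in> with_infinity {z. Some z \<in> C}" for y
        using that by (cases y) (auto simp: with_infinity_def)
    qed
    have A: "\<sigma> ` A = with_infinity K" and B: "\<sigma> ` B = with_infinity L"
      unfolding K_def L_def using x \<sigma>(2) by (metis split imageI)+
    have adm': "admissible (with_infinity K) (with_infinity L)"
      using admissible_projectivity[OF \<sigma>(1) adm] by (simp only: A B)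
    have two: "\<exists>z w. Some z \<in> \<sigma> ` C \<and> Some w \<in> \<sigma> ` C \<and> z \<noteq> w"
      if three: "{y1, y2, y3} \<subseteq> C" "distinct [y1, y2, y3]" for y1 y2 y3 C
    proof -
      \<comment> \<open>At most one of the three points is \<open>x\<close>, the point sent to
        infinity, so two of them remain finite.\<close>
      consider "y1 \<noteq> x" "y2 \<noteq> x" | "y1 \<noteq> x" "y3 \<noteq> x" | "y2 \<noteq> x" "y3 \<noteq> x"
        using three(2) by (cases "y1 = x"; cases "y2 = x") auto
      then obtain y y' where "y \<in> C" "y' \<in> C" "y \<noteq> y'" "y \<noteq> x" "y' \<noteq> x"
        using three by cases fastforce+
      then show ?thesis
        using \<sigma>_eq \<sigma>(2) by (metis imageI option.exhaust)
    qed
    obtain z z' where K: "z \<in> K" "z' \<in> K" "z \<noteq> z'"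
      using two[OF k] by (auto simp: K_def)
    obtain w w' where L: "w \<in> L" "w' \<in> L" "w \<noteq> w'"
      using two[OF l] by (auto simp: L_def)
    obtain c where c: "c \<noteq> 0" "\<And>k l. k \<in> K \<Longrightarrow> l \<in> L \<Longrightarrow> k \<noteq> l \<Longrightarrow> root_of_unity ((k - l) / c)"
      using scaled_unit_differences[OF adm'] by blast
    define f where "f = (\<lambda>z. inverse c * z + 0)"
    have ud: "unit_differences (f ` K) (f ` L)"
      using c(2) by (auto simp: unit_differences_def f_def divide_inverse mult.commute simp flip: left_diff_distrib)
    have neq: "f z \<noteq> f z'" "f w \<noteq> f w'"
      using K(3) L(3) c(1) by (simp_all add: f_def)
    have "classified \<omega> (with_infinity (f ` K)) (with_infinity (f ` L))"
      using classified_unit_differences[OF \<omega> ud imageI[OF K(1)] imageI[OF K(2)] neq(1)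
          imageI[OF L(1)] imageI[OF L(2)] neq(2)] .
    then have "classified \<omega> (with_infinity K) (with_infinity L)"
      unfolding f_def by (rule classified_affine[rotated]) (use c(1) in simp)
    then show ?thesis
      unfolding A[symmetric] B[symmetric] by (rule classified_projectivity[OF \<sigma>(1)])
  qed
qed

theorem theorem4p9:
  fixes M :: "(complex^2 \<Rightarrow> complex^2) set" and \<omega> :: complex
  assumes "primitive_cube_root \<omega>"
    and "projection_monoid (*s) M"
    and "irreducible_monoid (*s) M"
    and "finite M"
  shows "\<exists>N :: (complex^2 \<Rightarrow> complex^2) set.
    (equivalent_monoids (*s) (*s) M N \<or> equivalent_monoids dual_scale (*s) (dual_monoid M) N) \<and>
    ((\<exists>i S. i \<in> {0, 1, 2} \<and> finite S \<and> (\<forall>s\<in>S. root_of_unity s) \<and> 1 \<in> S \<and> i + card S \<ge> 2 \<and>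
        N = X_monoid i S) \<or>
     (\<exists>w. root_of_unity w \<and> w \<noteq> 1 \<and> w \<noteq> -1 \<and> N = Y_monoid w) \<or>
     (\<exists>i \<in> {0, 1, 2, 3, 4, 5}. N = Z_monoid \<omega> i))"
proof -
  obtain A B where "M = monoid_of A B" "admissible A B"
    using projection_monoid_eq_monoid_of[OF assms(2-4)] .
  moreover from this obtain N where "listed \<omega> N"
    "equivalent_monoids (*s) (*s) (monoid_of A B) N \<or> equivalent_monoids (*s) (*s) (monoid_of B A) N"
    using classified_admissible[OF assms(1)] unfolding classified_def by blast
  \<comment> \<open>In the second alternative, \<open>monoid_of B A\<close> is equivalent to the
    dual of \<open>M\<close>, and transitivity gives the equivalence of that dual with
    \<open>N\<close>.\<close>
  ultimately show ?thesis
    unfolding listed_def[symmetric] using equivalent_monoids_trans[OF equivalent_monoids_dual] by blast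
qed

end
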